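(* Let $\mu,\sigma,M>0$, $c\in(0,1)$, $0<\lambda<\delta$, and $\beta(t)=(1+\lambda t)\mathrm{e}^{-\delta t}$. Suppose there exist $0<x_1<x_2$ such that the functions $V_3,V_4$ defined in the context for these $x_1,x_2$ satisfy $V_4'(x_1)=-1$ and $V_4''(x_2-)=0$. Then $$f(x,t,s)=\mathrm{e}^{-\delta(t-s)}\big[\lambda(t-s)V_3(x)+V_4(x)\big]\quad(x\ge0,\ t\ge0,\ s\in[0,t]),\qquad V(x)=V_4(x)\quad(x\ge0)$$ are a solution to the extended HJB system (stated in the context) under the discount function $\beta$. In addition, $V$ is decreasing and convex on $[0,+\infty)$.
   Context: **Constants.** $\theta_1=\frac{-(\mu+M)+\sqrt{(\mu+M)^2+2\delta\sigma^2}}{\sigma^2}$, $\theta_2=\frac{\mu+M+\sqrt{(\mu+M)^2+2\delta\sigma^2}}{\sigma^2}$, $\theta_3=\frac{-\mu+\sqrt{\mu^2+2\delta\sigma^2}}{\sigma^2}$, $\theta_4=\frac{\mu+\sqrt{\mu^2+2\delta\sigma^2}}{\sigma^2}$. **The functions $V_3,V_4$.** For $0<x_1<x_2$: $V_3(x)=\frac M\delta+A_1\mathrm{e}^{\theta_1x}+A_2\mathrm{e}^{-\theta_2x}$ on $[0,x_1)$; $V_3(x)=A_3\mathrm{e}^{\theta_3x}+A_4\mathrm{e}^{-\theta_4x}$ on $[x_1,x_2)$; $V_3(x)=-cx+A_5$ on $[x_2,\infty)$, where $A_1,\dots,A_5$ are the constants (uniquely) determined by $V_3(0)=0$ and continuity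 of $V_3$ and $V_3'$ at $x_1$ and $x_2$. $V_4(x)=\frac M\delta\big(\frac\lambda\delta+1\big)-\frac{\lambda A_1}{\mu+M+\sigma^2\theta_1}x\mathrm{e}^{\theta_1x}+\frac{\lambda A_2}{-(\mu+M)+\sigma^2\theta_2}x\mathrm{e}^{-\theta_2x}+B_1\mathrm{e}^{\theta_1x}+B_2\mathrm{e}^{-\theta_2x}$ on $[0,x_1)$; $V_4(x)=-\frac{\lambda A_3}{\mu+\sigma^2\theta_3}x\mathrm{e}^{\theta_3x}+\frac{\lambda A_4}{-\mu+\sigma^2\theta_4}x\mathrm{e}^{-\theta_4x}+B_3\mathrm{e}^{\theta_3x}+B_4\mathrm{e}^{-\theta_4x}$ on $[x_1,x_2)$; $V_4(x)=-cx+B_5$ on $[x_2,\infty)$, where $B_1,\dots,B_5$ are the constants (uniquely) determined by $V_4(0)=0$ and continuity of $V_4$ and $V_4'$ at $x_1$ and $x_2$. **Extended HJB system.** Let $\tilde{\mathcal{Q}}=[0,\infty)^2$ (points $(x,t)$), and regard $V(x)$ as $V(x,t)$ independent of $t$. Let $\hat\Pi(x,t)=M$ for $0\le x<x_1$ and $\hat\Pi(x,t)=0$ for $x\ge x_1$; $W:=\{(x,t)\in\tilde{\mathcal{Q}}:-c-V_x(x,t)>0\}$, $P:=\{(x,t)\in\tilde{\mathcal{Q}}:-c-V_x(x,t)=0\}$. The system consists of: - $\hat\Pi(x,t)\in\operatorname{argmin}_{u\in[0,M]}\{V_t(x,t)+(\mu+u)V_x(x,t)+\frac12\sigma^2V_{xx}(x,t)+u-f_s(x,t,t)\}$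 for all $(x,t)\in\tilde{\mathcal{Q}}$; - $\min\{V_t+(\mu+\hat\Pi)V_x+\frac12\sigma^2V_{xx}+\hat\Pi-f_s(x,t,t),\ -c-V_x\}=0$ for all $(x,t)\in\tilde{\mathcal{Q}}$, and $V(0,t)=0$; - $f_t(x,t,s)+(\mu+\hat\Pi(x,t))f_x(x,t,s)+\frac12\sigma^2f_{xx}(x,t,s)+\beta(t-s)\hat\Pi(x,t)=0$ for $(x,t)\in\overline{W}$, $s\in[0,t]$; - $-\beta(t-s)c-f_x(x,t,s)=0$ for $(x,t)\in P$, $s\in[0,t]$, and $f(0,t,s)=0$. Convention: $f$ is $C^1$ but $f_{xx}$ may jump at $x_1,x_2$; at $x=x_1$ use $f_{xx}(x_1+,t,s)$ and at $x=x_2$ use $f_{xx}(x_2-,t,s)$. Derivatives at $x=0$ are one-sided. *)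

theory Defs
  imports "HOL-Analysis.Analysis"
begin

definition theta1 :: "real \<Rightarrow> real \<Rightarrow> real \<Rightarrow> real \<Rightarrow> real" where
  "theta1 \<mu> \<sigma> M \<delta> = (-(\<mu> + M) + sqrt ((\<mu> + M)^2 + 2 * \<delta> * \<sigma>^2)) / \<sigma>^2"

definition theta2 :: "real \<Rightarrow> real \<Rightarrow> real \<Rightarrow> real \<Rightarrow> real" where
  "theta2 \<mu> \<sigma> M \<delta> = (\<mu> + M + sqrt ((\<mu> + M)^2 + 2 * \<delta> * \<sigma>^2)) / \<sigma>^2"

definition theta3 :: "real \<Rightarrow> real \<Rightarrow> real \<Rightarrow> real" where
  "theta3 \<mu> \<sigma> \<delta> = (-\<mu> + sqrt (\<mu>^2 + 2 * \<delta> * \<sigma>^2)) / \<sigma>^2"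

definition theta4 :: "real \<Rightarrow> real \<Rightarrow> real \<Rightarrow> real" where
  "theta4 \<mu> \<sigma> \<delta> = (\<mu> + sqrt (\<mu>^2 + 2 * \<delta> * \<sigma>^2)) / \<sigma>^2"

text \<open>The coefficients \<open>A\<^sub>1, \<dots>, A\<^sub>5\<close> and \<open>B\<^sub>1, \<dots>, B\<^sub>5\<close> are the values at \<open>1, \<dots>, 5\<close> of
  functions \<open>A\<close> and \<open>B\<close> on the naturals. Only \<open>x \<ge> 0\<close> is meant; the first branch is used for
  negative \<open>x\<close> because functions are total.\<close>

definition V3_fun :: "real \<Rightarrow> real \<Rightarrow> real \<Rightarrow> real \<Rightarrow> real \<Rightarrow> real \<Rightarrow> real \<Rightarrow> (nat \<Rightarrow> real) \<Rightarrow> real \<Rightarrow> real" where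
  "V3_fun \<mu> \<sigma> M c \<delta> x1 x2 A x =
    (if x < x1 then
       M / \<delta> + A 1 * exp (theta1 \<mu> \<sigma> M \<delta> * x) + A 2 * exp (- theta2 \<mu> \<sigma> M \<delta> * x)
     else if x < x2 then
       A 3 * exp (theta3 \<mu> \<sigma> \<delta> * x) + A 4 * exp (- theta4 \<mu> \<sigma> \<delta> * x)
     else - c * x + A 5)"

definition V4_fun :: "real \<Rightarrow> real \<Rightarrow> real \<Rightarrow> real \<Rightarrow> real \<Rightarrow> real \<Rightarrow> real \<Rightarrow> real
    \<Rightarrow> (nat \<Rightarrow> real) \<Rightarrow> (nat \<Rightarrow> real) \<Rightarrow> real \<Rightarrow> real" where
  "V4_fun \<mu> \<sigma> M c \<delta> l x1 x2 A B x =
    (if x < x1 then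
       M / \<delta> * (l / \<delta> + 1)
       - l * A 1 / (\<mu> + M + \<sigma>^2 * theta1 \<mu> \<sigma> M \<delta>) * x * exp (theta1 \<mu> \<sigma> M \<delta> * x)
       + l * A 2 / (-(\<mu> + M) + \<sigma>^2 * theta2 \<mu> \<sigma> M \<delta>) * x * exp (- theta2 \<mu> \<sigma> M \<delta> * x)
       + B 1 * exp (theta1 \<mu> \<sigma> M \<delta> * x) + B 2 * exp (- theta2 \<mu> \<sigma> M \<delta> * x)
     else if x < x2 then
       - l * A 3 / (\<mu> + \<sigma>^2 * theta3 \<mu> \<sigma> \<delta>) * x * exp (theta3 \<mu> \<sigma> \<delta> * x)
       + l * A 4 / (- \<mu> + \<sigma>^2 * theta4 \<mu> \<sigma> \<delta>) * x * exp (- theta4 \<mu> \<sigma> \<delta> * x)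
       + B 3 * exp (theta3 \<mu> \<sigma> \<delta> * x) + B 4 * exp (- theta4 \<mu> \<sigma> \<delta> * x)
     else - c * x + B 5)"

definition C1_at :: "(real \<Rightarrow> real) \<Rightarrow> real \<Rightarrow> bool" where
  "C1_at g a \<longleftrightarrow> isCont g a \<and> g differentiable (at a) \<and> isCont (deriv g) a"

definition Pi_hat :: "real \<Rightarrow> real \<Rightarrow> real \<Rightarrow> real \<Rightarrow> real" where
  "Pi_hat M x1 x t = (if x < x1 then M else 0)"

definition state_time :: "(real \<times> real) set" where
  "state_time = {(x, t). 0 \<le> x \<and> 0 \<le> t}"

definition state_time_init :: "(real \<times> real \<times> real) set" where
  "state_time_init = {(x, t, s). 0 \<le> x \<and> 0 \<le> s \<and> s \<le> t}"

text \<open>The derivatives of \<open>V\<close> and \<open>f\<close> are carried as explicit functions, tied to \<open>V\<close> and \<open>f\<close>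
  by the next two predicates; all are taken within the closed domains, hence one-sided on the
  boundary.\<close>

definition V_derivs :: "(real \<Rightarrow> real \<Rightarrow> real)
    \<Rightarrow> (real \<Rightarrow> real \<Rightarrow> real) \<Rightarrow> (real \<Rightarrow> real \<Rightarrow> real) \<Rightarrow> (real \<Rightarrow> real \<Rightarrow> real) \<Rightarrow> bool" where
  "V_derivs V Vt Vx Vxx \<longleftrightarrow>
    (\<forall>(x, t) \<in> state_time.
       ((\<lambda>\<tau>. V x \<tau>) has_real_derivative Vt x t) (at t within {0..}) \<and>
       ((\<lambda>y. V y t) has_real_derivative Vx x t) (at x within {0..}) \<and>
       ((\<lambda>y. Vx y t) has_real_derivative Vxx x t) (at x within {0..}))"

text \<open>\<open>f\<close> is \<open>C\<^sup>1\<close> on the convex set \<open>{0 \<le> x, 0 \<le> s \<le> t}\<close>. This set has nonempty interior,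
  so the total derivative within it is unique at every point, including the edge \<open>s = t = 0\<close>,
  where the line in direction \<open>s\<close> leaves the set; thus \<open>f\<^sub>s(x,t,t)\<close> makes sense for all
  \<open>t \<ge> 0\<close>. The values of \<open>f\<^sub>x\<^sub>x\<close> at \<open>x\<^sub>1\<close> and \<open>x\<^sub>2\<close> are the one-sided limits
  \<open>f\<^sub>x\<^sub>x(x\<^sub>1+,t,s)\<close> and \<open>f\<^sub>x\<^sub>x(x\<^sub>2-,t,s)\<close>.\<close>

definition f_derivs :: "real \<Rightarrow> real \<Rightarrow> (real \<Rightarrow> real \<Rightarrow> real \<Rightarrow> real)
    \<Rightarrow> (real \<Rightarrow> real \<Rightarrow> real \<Rightarrow> real) \<Rightarrow> (real \<Rightarrow> real \<Rightarrow> real \<Rightarrow> real) \<Rightarrow> (real \<Rightarrow> real \<Rightarrow> real \<Rightarrow> real)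
    \<Rightarrow> (real \<Rightarrow> real \<Rightarrow> real \<Rightarrow> real) \<Rightarrow> bool" where
  "f_derivs x1 x2 f fx ft fs fxx \<longleftrightarrow>
    (\<forall>(x, t, s) \<in> state_time_init.
       ((\<lambda>(x, t, s). f x t s) has_derivative
          (\<lambda>(h, k, l). fx x t s * h + ft x t s * k + fs x t s * l))
        (at (x, t, s) within state_time_init)) \<and>
    continuous_on state_time_init (\<lambda>(x, t, s). fx x t s) \<and>
    continuous_on state_time_init (\<lambda>(x, t, s). ft x t s) \<and>
    continuous_on state_time_init (\<lambda>(x, t, s). fs x t s) \<and>
    (\<forall>(x, t, s) \<in> state_time_init. x \<noteq> x1 \<and> x \<noteq> x2 \<longrightarrow>
       ((\<lambda>y. fx y t s) has_real_derivative fxx x t s) (at x within {0..})) \<and>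
    (\<forall>t s. 0 \<le> s \<and> s \<le> t \<longrightarrow>
       ((\<lambda>y. fxx y t s) \<longlongrightarrow> fxx x1 t s) (at_right x1) \<and>
       ((\<lambda>y. fxx y t s) \<longlongrightarrow> fxx x2 t s) (at_left x2))"

definition extended_HJB_solution :: "real \<Rightarrow> real \<Rightarrow> real \<Rightarrow> real \<Rightarrow> (real \<Rightarrow> real) \<Rightarrow> real \<Rightarrow> real
    \<Rightarrow> (real \<Rightarrow> real \<Rightarrow> real \<Rightarrow> real) \<Rightarrow> (real \<Rightarrow> real \<Rightarrow> real) \<Rightarrow> bool" where
  "extended_HJB_solution \<mu> \<sigma> M c \<beta> x1 x2 f V \<longleftrightarrow>
    (\<exists>Vt Vx Vxx fx ft fs fxx.
      V_derivs V Vt Vx Vxx \<and> f_derivs x1 x2 f fx ft fs fxx \<and>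
      (let pihat = Pi_hat M x1;
           W = {(x, t) \<in> state_time. - c - Vx x t > 0};
           P = {(x, t) \<in> state_time. - c - Vx x t = 0}
       in
        (\<forall>(x, t) \<in> state_time.
           is_arg_min
             (\<lambda>u. Vt x t + (\<mu> + u) * Vx x t + 1/2 * \<sigma>^2 * Vxx x t + u - fs x t t)
             (\<lambda>u. u \<in> {0..M}) (pihat x t)) \<and>
        (\<forall>(x, t) \<in> state_time.
           min (Vt x t + (\<mu> + pihat x t) * Vx x t + 1/2 * \<sigma>^2 * Vxx x t + pihat x t - fs x t t)
               (- c - Vx x t) = 0) \<and>
        (\<forall>t\<ge>0. V 0 t = 0) \<and>
        (\<forall>(x, t) \<in> closure W. \<forall>s \<in> {0..t}.
           ft x t s + (\<mu> + pihat x t) * fx x t s + 1/2 * \<sigma>^2 * fxx x t s + \<beta> (t - s) * pihat x t = 0) \<and>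
        (\<forall>(x, t) \<in> P. \<forall>s \<in> {0..t}. - \<beta> (t - s) * c - fx x t s = 0) \<and>
        (\<forall>t\<ge>0. \<forall>s \<in> {0..t}. f 0 t s = 0)))"

end

theory Submission
  imports Defs
begin

text \<open>Write \<open>u = V\<^sub>3'\<close>, \<open>v = V\<^sub>4'\<close>, \<open>\<kappa> = \<sigma>\<^sup>2 / 2\<close>, and let \<open>b\<close> be the drift, \<open>\<mu> + M\<close> below \<open>x\<^sub>1\<close> and
\<open>\<mu>\<close> between \<open>x\<^sub>1\<close> and \<open>x\<^sub>2\<close>. The explicit formulas are the general solutions of
\<open>\<kappa>V\<^sub>3'' + bV\<^sub>3' - \<delta>V\<^sub>3 + \<Pi> = 0\<close> and \<open>\<kappa>V\<^sub>4'' + bV\<^sub>4' - \<delta>V\<^sub>4 + \<lambda>V\<^sub>3 + \<Pi> = 0\<close> on \<open>[0, x\<^sub>2]\<close>. With these two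
equations the equation for \<open>f\<close> is an identity: the factor of \<open>\<lambda>(t - s)\<close> is the first one and the rest
is the second one. The condition \<open>V\<^sub>4'(x\<^sub>1) = -1\<close> makes \<open>b v + \<Pi>\<close> continuous at \<open>x\<^sub>1\<close>, so together with
\<open>V\<^sub>4''(x\<^sub>2-) = 0\<close> the function \<open>V\<^sub>4\<close> is \<open>C\<^sup>2\<close>. Everything else in the system is a sign condition:
\<open>v\<close> has to be at most \<open>-1\<close> below \<open>x\<^sub>1\<close>, at least \<open>-1\<close> above it and less than \<open>-c\<close> below \<open>x\<^sub>2\<close>, and
beyond \<open>x\<^sub>2\<close> the linear function \<open>-\<mu>c - \<delta>V\<^sub>4 + \<lambda>V\<^sub>3\<close>, which vanishes at \<open>x\<^sub>2\<close> and has slope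
\<open>(\<delta> - \<lambda>)c > 0\<close>, has to be nonnegative. So all reduces to \<open>V\<^sub>4'' > 0\<close> on \<open>[0, x\<^sub>2)\<close>.

Differentiating gives \<open>\<kappa>v'' + bv' - \<delta>v + \<lambda>u = 0\<close>, hence \<open>\<kappa>v''(x\<^sub>2-) = -(\<delta> - \<lambda>)c < 0\<close>, and \<open>v' > 0\<close> just
to the left of \<open>x\<^sub>2\<close>. If \<open>z\<close> were the last zero of \<open>v'\<close>, then \<open>v\<close> increases after \<open>z\<close>, so that
\<open>v(z) < -c\<close> (and \<open>v(z) < -1\<close> if \<open>z < x\<^sub>1\<close>), while \<open>\<kappa>v''(z) = \<delta>v(z) - \<lambda>u(z)\<close> must not be negative.
Thus it suffices that \<open>\<lambda>u > \<delta>v\<close> wherever \<open>v\<close> is so negative (lemma \<open>forcing_dominates\<close>).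

This comparison comes from the maximum principle for \<open>u\<close>, for the gap \<open>V\<^sub>4 - V\<^sub>3\<close> and for its
derivative \<open>v - u\<close>, whose equations have right-hand sides of known sign, and from the jump
\<open>\<kappa>(u'(x\<^sub>1+) - u'(x\<^sub>1-)) = M(u(x\<^sub>1) + 1)\<close>. There are two cases.
If \<open>u(0) < 0\<close> (lemma \<open>decreasing_start\<close>), then \<open>u \<le> 0\<close> on \<open>[0, x\<^sub>2]\<close>; the gap cannot start with a
positive slope, since it would keep increasing up to \<open>x\<^sub>2\<close> where its slope is \<open>-c + c = 0\<close>; it follows
that \<open>v \<le> u \<le> 0\<close> throughout, which is enough because \<open>\<lambda> < \<delta>\<close>.
If \<open>u(0) \<ge> 0\<close> (lemma \<open>increasing_start\<close>), then \<open>u \<ge> -1\<close> on \<open>[0, x\<^sub>1]\<close>, and on \<open>[x\<^sub>1, x\<^sub>2]\<close> either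
\<open>u \<ge> -c\<close> or again \<open>v \<le> u \<le> 0\<close>.\<close>

section \<open>A maximum principle for second-order equations\<close>

text \<open>The functions of interest are restrictions of solutions on the whole line, so derivatives are
taken at every real point and one-sided derivatives at the ends of an interval need no care; only
the inequality is confined to \<open>S\<close>.\<close>
definition subsolution ::
  "real \<Rightarrow> real \<Rightarrow> real \<Rightarrow> real set \<Rightarrow> (real \<Rightarrow> real) \<Rightarrow> (real \<Rightarrow> real) \<Rightarrow> bool" where
  "subsolution \<kappa> b \<delta> S y y' \<longleftrightarrow>
    (\<forall>x. (y has_real_derivative y' x) (at x)) \<and>
    (\<exists>y''. \<forall>x. (y' has_real_derivative y'' x) (at x) \<and>
            (x \<in> S \<longrightarrow> \<delta> * y x \<le> \<kappa> * y'' x + b * y' x))"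

text \<open>The local form of the maximum principle: where \<open>y > 0\<close> and \<open>y' = 0\<close>, the inequality forces
\<open>y'' > 0\<close>.\<close>
lemma subsolution_strict_min_at_positive_critical_point:
  assumes "subsolution \<kappa> b \<delta> S y y'" "\<kappa> > 0" "\<delta> > 0" "x \<in> S" "y x > 0" "y' x = 0"
  obtains e where "e > 0" "\<And>h. 0 < h \<Longrightarrow> h < e \<Longrightarrow> y x < y (x + h) \<and> y x < y (x - h)"
proof -
  obtain y'' where d1: "\<And>x. (y has_real_derivative y' x) (at x)"
    and d2: "\<And>x. (y' has_real_derivative y'' x) (at x)"
    and ineq: "\<And>x. x \<in> S \<Longrightarrow> \<delta> * y x \<le> \<kappa> * y'' x + b * y' x"
    using assms(1) unfolding subsolution_def by blast
  have "0 < \<delta> * y x" using assms by simp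
  also have "\<dots> \<le> \<kappa> * y'' x" using ineq[OF \<open>x \<in> S\<close>] assms(6) by simp
  finally have "0 < y'' x" using \<open>\<kappa> > 0\<close> by (simp add: zero_less_mult_iff)
  obtain e1 where e1: "e1 > 0" "\<And>h. 0 < h \<Longrightarrow> h < e1 \<Longrightarrow> 0 < y' (x + h)"
    using DERIV_pos_inc_right[OF d2[of x] \<open>0 < y'' x\<close>] assms(6) by auto
  obtain e2 where e2: "e2 > 0" "\<And>h. 0 < h \<Longrightarrow> h < e2 \<Longrightarrow> y' (x - h) < 0"
    using DERIV_pos_inc_left[OF d2[of x] \<open>0 < y'' x\<close>] assms(6) by auto
  have cont: "continuous_on A y" for A
    using d1 by (meson DERIV_continuous_on has_field_derivative_at_within)
  show thesis
  proof (rule that[of "min e1 e2"])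
    show "min e1 e2 > 0" using e1 e2 by simp
    fix h :: real assume h: "0 < h" "h < min e1 e2"
    have "y x < y (x + h)"
    proof (rule DERIV_pos_imp_increasing_open[OF _ _ cont])
      fix z assume "x < z" "z < x + h"
      then have "0 < y' (x + (z - x))" using e1(2)[of "z - x"] h by simp
      then show "\<exists>D. (y has_real_derivative D) (at z) \<and> 0 < D" using d1[of z] by auto
    qed (use h in auto)
    moreover have "y x < y (x - h)"
    proof (rule DERIV_neg_imp_decreasing_open[OF _ _ cont])
      fix z assume "x - h < z" "z < x"
      then have "y' (x - (x - z)) < 0" using e2(2)[of "x - z"] h by simp
      then show "\<exists>D. (y has_real_derivative D) (at z) \<and> D < 0" using d1[of z] by auto
    qed (use h in auto)
    ultimately show "y x < y (x + h) \<and> y x < y (x - h)" by simp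
  qed
qed

lemma subsolution_nonpos_between:
  assumes sub: "subsolution \<kappa> b \<delta> {lo..hi} y y'" and pos: "\<kappa> > 0" "\<delta> > 0"
    and ends: "y lo \<le> 0" "y hi \<le> 0" and x: "x \<in> {lo..hi}"
  shows "y x \<le> 0"
proof (rule ccontr)
  assume "\<not> y x \<le> 0"
  have d1: "\<And>x. (y has_real_derivative y' x) (at x)"
    using sub unfolding subsolution_def by blast
  then have "continuous_on {lo..hi} y"
    by (meson DERIV_continuous_on has_field_derivative_at_within)
  then obtain t where t: "t \<in> {lo..hi}" "\<And>z. z \<in> {lo..hi} \<Longrightarrow> y z \<le> y t"
    using continuous_attains_sup[of "{lo..hi}" y] x by auto
  have yt: "y t > 0" using t(2)[OF x] \<open>\<not> y x \<le> 0\<close> by simp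
  then have "lo < t" "t < hi" using ends t(1) by (auto simp: less_le)
  have "y' t = 0"
    by (rule DERIV_local_max[OF d1, of "min (t - lo) (hi - t)"])
      (use \<open>lo < t\<close> \<open>t < hi\<close> t(2) in \<open>auto simp: abs_if split: if_splits\<close>)
  then obtain e where e: "e > 0" "\<And>h. 0 < h \<Longrightarrow> h < e \<Longrightarrow> y t < y (t + h) \<and> y t < y (t - h)"
    using subsolution_strict_min_at_positive_critical_point[OF sub pos t(1) yt] by metis
  define h where "h = min (e / 2) (hi - t)"
  have "0 < h" "h < e" "t + h \<in> {lo..hi}"
    using e(1) \<open>t < hi\<close> \<open>lo < t\<close> by (auto simp: h_def min_def)
  then show False using e(2)[of h] t(2)[of "t + h"] by force
qed

text \<open>A subsolution that starts upwards from a nonnegative value attains its maximum over the interval at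
the right end: at any other maximum it would be positive and critical, hence at a strict minimum.\<close>
lemma subsolution_rises_rightwards:
  assumes sub: "subsolution \<kappa> b \<delta> {lo..hi} y y'" and pos: "\<kappa> > 0" "\<delta> > 0" "lo < hi"
    and start: "0 \<le> y lo" "0 \<le> y' lo" "0 < y lo \<or> 0 < y' lo"
  shows "y lo < y hi" "0 < y' hi"
proof -
  have d1: "\<And>x. (y has_real_derivative y' x) (at x)"
    using sub unfolding subsolution_def by blast
  then have "continuous_on {lo..hi} y"
    by (meson DERIV_continuous_on has_field_derivative_at_within)
  then obtain t where t: "t \<in> {lo..hi}" "\<And>z. z \<in> {lo..hi} \<Longrightarrow> y z \<le> y t"
    using continuous_attains_sup[of "{lo..hi}" y] \<open>lo < hi\<close> by auto
  have no_rise: False if "e > 0" "t < hi" "\<And>h. 0 < h \<Longrightarrow> h < e \<Longrightarrow> y t < y (t + h)" for e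
  proof -
    define h where "h = min (e / 2) (hi - t)"
    have "0 < h" "h < e" "t + h \<in> {lo..hi}"
      using that(1,2) t(1) by (auto simp: h_def min_def)
    then show False using that(3)[of h] t(2)[of "t + h"] by force
  qed
  have lo_less: "y lo < y t" if y'_lo: "0 < y' lo"
  proof -
    obtain e where e: "e > 0" "\<And>h. 0 < h \<Longrightarrow> h < e \<Longrightarrow> y lo < y (lo + h)"
      using DERIV_pos_inc_right[OF d1[of lo] y'_lo] by auto
    define h where "h = min (e / 2) (hi - lo)"
    have "0 < h" "h < e" "lo + h \<in> {lo..hi}"
      using e(1) \<open>lo < hi\<close> by (auto simp: h_def min_def)
    then show ?thesis using e(2)[of h] t(2)[of "lo + h"] by force
  qed
  have yt: "y t > 0" using start lo_less t(2)[of lo] \<open>lo < hi\<close> by auto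
  have crit: False if "y' t = 0" "t < hi"
    using subsolution_strict_min_at_positive_critical_point[OF sub pos(1,2) t(1) yt that(1)]
      no_rise[OF _ that(2)] by metis
  have "t = hi"
  proof (rule ccontr)
    assume "t \<noteq> hi"
    then have "t < hi" using t(1) by simp
    show False
    proof (cases "t = lo")
      case True
      then have "\<not> 0 < y' lo" using lo_less by auto
      then show False using crit True start \<open>t < hi\<close> by simp
    next
      case False
      then have "lo < t" using t(1) by simp
      have "y' t = 0"
        by (rule DERIV_local_max[OF d1, of "min (t - lo) (hi - t)"])
          (use \<open>lo < t\<close> \<open>t < hi\<close> t(2) in \<open>auto simp: abs_if split: if_splits\<close>)
      then show False using crit \<open>t < hi\<close> by blast
    qed
  qed
  have no_drop: False if "e > 0" "\<And>h. 0 < h \<Longrightarrow> h < e \<Longrightarrow> y hi < y (hi - h)" for e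
  proof -
    define h where "h = min (e / 2) (hi - lo)"
    have "0 < h" "h < e" "hi - h \<in> {lo..hi}"
      using that(1) \<open>lo < hi\<close> by (auto simp: h_def min_def)
    then show False using that(2)[of h] t(2)[of "hi - h"] \<open>t = hi\<close> by force
  qed
  have "\<not> y' hi < 0"
    using DERIV_neg_dec_left[OF d1[of hi]] no_drop by metis
  moreover have "y' hi \<noteq> 0"
    using subsolution_strict_min_at_positive_critical_point[OF sub pos(1,2) t(1) yt]
      no_drop \<open>t = hi\<close> by metis
  ultimately show "0 < y' hi" by simp
  show "y lo < y hi"
  proof (rule ccontr)
    assume "\<not> y lo < y hi"
    then have eq: "y lo = y hi" using t(2)[of lo] \<open>t = hi\<close> \<open>lo < hi\<close> by auto
    then have "\<not> 0 < y' lo" using lo_less \<open>t = hi\<close> by auto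
    then have "y' lo = 0" "0 < y lo" using start by auto
    then obtain e where e: "e > 0" "\<And>h. 0 < h \<Longrightarrow> h < e \<Longrightarrow> y lo < y (lo + h)"
      using subsolution_strict_min_at_positive_critical_point[OF sub pos(1,2), of lo] \<open>lo < hi\<close>
      by (metis atLeastAtMost_iff less_eq_real_def)
    define h where "h = min (e / 2) (hi - lo)"
    have "0 < h" "h < e" "lo + h \<in> {lo..hi}"
      using e(1) \<open>lo < hi\<close> by (auto simp: h_def min_def)
    then show False using e(2)[of h] t(2)[of "lo + h"] eq \<open>t = hi\<close> by force
  qed
qed

lemma subsolution_reflect:
  assumes "subsolution \<kappa> b \<delta> {lo..hi} y y'"
  shows "subsolution \<kappa> (- b) \<delta> {- hi..- lo} (\<lambda>x. y (- x)) (\<lambda>x. - y' (- x))"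
proof -
  obtain y'' where d1: "\<And>x. (y has_real_derivative y' x) (at x)"
    and d2: "\<And>x. (y' has_real_derivative y'' x) (at x)"
    and ineq: "\<And>x. x \<in> {lo..hi} \<Longrightarrow> \<delta> * y x \<le> \<kappa> * y'' x + b * y' x"
    using assms(1) unfolding subsolution_def by blast
  have "((\<lambda>x. y (- x)) has_real_derivative - y' (- x)) (at x)" for x
    using DERIV_chain2[OF d1[of "- x"] DERIV_minus[OF DERIV_ident]] by simp
  moreover have "((\<lambda>x. - y' (- x)) has_real_derivative y'' (- x)) (at x)" for x
    using DERIV_minus[OF DERIV_chain2[OF d2[of "- x"] DERIV_minus[OF DERIV_ident]]] by simp
  ultimately show ?thesis
    unfolding subsolution_def using ineq
    by (intro conjI allI exI[of _ "\<lambda>x. y'' (- x)"]) auto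
qed

lemma subsolution_rises_leftwards:
  assumes sub: "subsolution \<kappa> b \<delta> {lo..hi} y y'" and pos: "\<kappa> > 0" "\<delta> > 0" "lo < hi"
    and start: "0 \<le> y hi" "y' hi \<le> 0" "0 < y hi \<or> y' hi < 0"
  shows "y hi < y lo"
  using subsolution_rises_rightwards(1)[OF subsolution_reflect[OF sub] pos(1,2)] pos(3) start
  by simp

text \<open>An equation of second order gives the third derivative: solve for \<open>y''\<close> and differentiate.\<close>
lemma DERIV_of_ODE:
  assumes "\<kappa> \<noteq> 0"
    and "\<And>x. (y has_real_derivative y' x) (at x)" "\<And>x. (y' has_real_derivative y'' x) (at x)"
    and "\<And>x. (h has_real_derivative h' x) (at x)"
    and ode: "\<And>x. \<kappa> * y'' x + b * y' x - \<delta> * y x + h x = 0"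
  shows "(y'' has_real_derivative (\<delta> * y' x - b * y'' x - h' x) / \<kappa>) (at x)"
proof -
  have "y'' = (\<lambda>x. (\<delta> * y x - b * y' x - h x) / \<kappa>)"
  proof
    fix x
    show "y'' x = (\<delta> * y x - b * y' x - h x) / \<kappa>"
      using ode[of x] \<open>\<kappa> \<noteq> 0\<close> by (simp add: field_simps)
  qed
  moreover have "((\<lambda>x. (\<delta> * y x - b * y' x - h x) / \<kappa>) has_real_derivative
      (\<delta> * y' x - b * y'' x - h' x) / \<kappa>) (at x)"
    using assms by (auto intro!: derivative_eq_intros)
  ultimately show ?thesis by simp
qed

lemma has_real_derivative_pos_imp_less:
  fixes f :: "real \<Rightarrow> real"
  assumes "\<And>x. (f has_real_derivative f' x) (at x)" "a < b" "\<And>x. a < x \<Longrightarrow> x < b \<Longrightarrow> 0 < f' x"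
  shows "f a < f b"
proof (rule DERIV_pos_imp_increasing_open[OF assms(2)])
  show "continuous_on {a..b} f"
    using assms(1) by (meson DERIV_continuous_on has_field_derivative_at_within)
qed (use assms in blast)

lemma subsolution_of_ODE:
  assumes "\<And>x. (y has_real_derivative y' x) (at x)" "\<And>x. (y' has_real_derivative y'' x) (at x)"
    and ode: "\<And>x. \<kappa> * y'' x + b * y' x - \<delta> * y x + h x = 0"
    and "\<And>x. x \<in> S \<Longrightarrow> h x \<le> 0"
  shows "subsolution \<kappa> b \<delta> S y y'"
  unfolding subsolution_def
proof (intro conjI allI exI)
  show "x \<in> S \<longrightarrow> \<delta> * y x \<le> \<kappa> * y'' x + b * y' x" for x
    using assms(4)[of x] ode[of x] by auto
qed (use assms in auto)

text \<open>The derivative of a solution solves the same equation with \<open>h'\<close> in place of \<open>h\<close>.\<close>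
lemma subsolution_derivative_of_ODE:
  assumes "\<kappa> \<noteq> 0"
    and "\<And>x. (y has_real_derivative y' x) (at x)" "\<And>x. (y' has_real_derivative y'' x) (at x)"
    and "\<And>x. (h has_real_derivative h' x) (at x)"
    and ode: "\<And>x. \<kappa> * y'' x + b * y' x - \<delta> * y x + h x = 0"
    and "\<And>x. x \<in> S \<Longrightarrow> h' x \<le> 0"
  shows "subsolution \<kappa> b \<delta> S y' y''"
  by (rule subsolution_of_ODE[where h = h', OF assms(3) DERIV_of_ODE[OF assms(1-5)]])
    (use assms(1,6) in auto)

text \<open>The last zero of \<open>g\<close> before \<open>hi\<close> is a point after which \<open>g\<close> is positive, so \<open>g\<close> cannot have a
negative derivative there.\<close>
lemma positive_up_to_right_end:
  assumes deriv: "\<And>x. (g has_real_derivative g' x) (at x)"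
    and near: "eventually (\<lambda>x. g x > 0) (at_left hi)"
    and zero: "\<And>z. lo \<le> z \<Longrightarrow> z < hi \<Longrightarrow> g z = 0 \<Longrightarrow> (\<And>x. z < x \<Longrightarrow> x < hi \<Longrightarrow> g x > 0) \<Longrightarrow> g' z < 0"
    and x: "lo \<le> x" "x < hi"
  shows "(g x :: real) > 0"
proof (rule ccontr)
  assume "\<not> g x > 0"
  obtain m where m: "m < hi" "\<And>y. m < y \<Longrightarrow> y < hi \<Longrightarrow> g y > 0"
    using near unfolding eventually_at_left[OF x(2)] by auto
  have cont: "continuous_on A g" for A
    using deriv by (meson DERIV_continuous_on has_field_derivative_at_within)
  define S where "S = {t \<in> {x..m}. g t \<le> 0}"
  have "x \<le> m" using m(2)[of x] \<open>\<not> g x > 0\<close> x(2) by (meson not_le)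
  then have "x \<in> S" using \<open>\<not> g x > 0\<close> unfolding S_def by simp
  have "S = {x..m} \<inter> {t. g t \<le> 0}" unfolding S_def by blast
  then have "compact S"
    by (simp add: compact_Int_closed closed_Collect_le cont)
  then obtain z where z: "z \<in> S" "\<And>t. t \<in> S \<Longrightarrow> t \<le> z"
    using compact_attains_sup[of S] \<open>x \<in> S\<close> by blast
  have after: "g t > 0" if "z < t" "t < hi" for t
  proof (rule ccontr)
    assume "\<not> 0 < g t"
    then have "t \<in> S" using z(1) that m(2)[of t] unfolding S_def by force
    then show False using z(2) that(1) by force
  qed
  have "z < hi" "x \<le> z" using z m unfolding S_def by auto
  have "g z = 0"
  proof (rule ccontr)
    assume "g z \<noteq> 0"
    then have "g z < 0" using z unfolding S_def by auto
    then have "eventually (\<lambda>t. g t < 0) (at_right z)"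
      using DERIV_isCont[OF deriv, of z]
      by (metis isCont_def filterlim_at_split order_tendstoD(2))
    moreover have "eventually (\<lambda>t. t \<in> {z<..<hi}) (at_right z)"
      using eventually_at_right_real[OF \<open>z < hi\<close>] .
    ultimately have "eventually (\<lambda>t. False) (at_right z)"
      by eventually_elim (use after in force)
    then show False by simp
  qed
  then have "g' z < 0" using zero[of z] after \<open>z < hi\<close> \<open>x \<le> z\<close> x by auto
  then obtain e where e: "e > 0" "\<And>h. 0 < h \<Longrightarrow> h < e \<Longrightarrow> g (z + h) < g z"
    using DERIV_neg_dec_right[OF deriv[of z]] by metis
  define h where "h = min (e / 2) ((hi - z) / 2)"
  have "0 < h" "h < e" "z + h < hi"
    using e(1) \<open>z < hi\<close> by (auto simp: h_def min_def field_simps)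
  then show False using e(2)[of h] after[of "z + h"] \<open>g z = 0\<close> by force
qed

section \<open>Functions glued from three pieces\<close>

definition glue :: "real \<Rightarrow> real \<Rightarrow> (real \<Rightarrow> real) \<Rightarrow> (real \<Rightarrow> real) \<Rightarrow> (real \<Rightarrow> real) \<Rightarrow> real \<Rightarrow> real" where
  "glue x1 x2 f g h x = (if x < x1 then f x else if x < x2 then g x else h x)"

lemma DERIV_transform_open:
  fixes f g :: "real \<Rightarrow> real"
  assumes "(f has_real_derivative D) (at x)" "open S" "x \<in> S" "\<And>y. y \<in> S \<Longrightarrow> f y = g y"
  shows "(g has_real_derivative D) (at x)"
  using assms has_field_derivative_transform_within_open by blast

lemma DERIV_at_corner:
  fixes F f g :: "real \<Rightarrow> real"
  assumes f: "(f has_real_derivative D) (at x)" and g: "(g has_real_derivative D) (at x)"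
    and lo: "lo < x" "\<And>y. lo < y \<Longrightarrow> y \<le> x \<Longrightarrow> F y = f y"
    and hi: "x < hi" "\<And>y. x \<le> y \<Longrightarrow> y < hi \<Longrightarrow> F y = g y"
  shows "(F has_real_derivative D) (at x)"
proof -
  have "eventually (\<lambda>y. F y = f y) (at_left x)"
    using eventually_at_left_real[OF lo(1)] by eventually_elim (use lo in auto)
  then have "(F has_real_derivative D) (at_left x)"
    using has_field_derivative_cong_eventually[of F f x "{..<x}"] lo
      has_field_derivative_at_within[OF f] by auto
  moreover have "eventually (\<lambda>y. F y = g y) (at_right x)"
    using eventually_at_right_real[OF hi(1)] by eventually_elim (use hi in auto)
  then have "(F has_real_derivative D) (at_right x)"
    using has_field_derivative_cong_eventually[of F g x "{x<..}"] hi
      has_field_derivative_at_within[OF g] by auto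
  ultimately show ?thesis
    by (simp add: has_field_derivative_iff filterlim_at_split)
qed

text \<open>The converse of the preceding lemma: differentiability at the corner forces the values and the
derivatives of the two pieces to agree. The pieces are differentiable at \<open>x\<close> itself, so both
one-sided derivatives of \<open>F\<close> are known.\<close>
lemma DERIV_corner_match:
  fixes F f g :: "real \<Rightarrow> real"
  assumes F: "isCont F x" "F differentiable (at x)"
    and f: "(f has_real_derivative f') (at x)" and g: "(g has_real_derivative g') (at x)"
    and lo: "lo < x" "\<And>y. lo < y \<Longrightarrow> y < x \<Longrightarrow> F y = f y"
    and hi: "x < hi" "\<And>y. x \<le> y \<Longrightarrow> y < hi \<Longrightarrow> F y = g y"
  shows "f x = g x" "f' = g'" "deriv F x = g'"
proof -
  have Fx: "F x = g x" using hi by auto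
  have near_f: "eventually (\<lambda>y. F y = f y) (at_left x)"
    using eventually_at_left_real[OF lo(1)] by eventually_elim (use lo in auto)
  have near_g: "eventually (\<lambda>y. F y = g y) (at_right x)"
    using eventually_at_right_real[OF hi(1)] by eventually_elim (use hi in auto)
  have "(F \<longlongrightarrow> g x) (at_left x)"
    using F(1) Fx by (metis isCont_def filterlim_at_split)
  then have "(f \<longlongrightarrow> g x) (at_left x)"
    using near_f by (rule Lim_transform_eventually)
  moreover have "(f \<longlongrightarrow> f x) (at_left x)"
    using DERIV_isCont[OF f] by (metis isCont_def filterlim_at_split)
  ultimately show eq: "f x = g x"
    using tendsto_unique trivial_limit_at_left_real by metis
  obtain D where D: "(F has_real_derivative D) (at x)"
    using F(2) real_differentiable_def by blast
  have "(f has_real_derivative D) (at_left x)"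
    using has_field_derivative_cong_eventually[OF near_f] eq Fx
      has_field_derivative_at_within[OF D] by auto
  then have "D = f'"
    using has_field_derivative_at_within[OF f] tendsto_unique[OF trivial_limit_at_left_real]
    unfolding has_field_derivative_iff by blast
  have "(g has_real_derivative D) (at_right x)"
    using has_field_derivative_cong_eventually[OF near_g] Fx
      has_field_derivative_at_within[OF D] by auto
  then have "D = g'"
    using has_field_derivative_at_within[OF g] tendsto_unique[OF trivial_limit_at_right_real]
    unfolding has_field_derivative_iff by blast
  show "f' = g'" using \<open>D = f'\<close> \<open>D = g'\<close> by simp
  show "deriv F x = g'" using D \<open>D = g'\<close> by (simp add: DERIV_imp_deriv)
qed

text \<open>The matching conditions are only asked for when \<open>x\<close> is the breakpoint in question, so that the
lemma also differentiates functions with corners away from these corners.\<close>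
lemma DERIV_glue:
  assumes "x1 < x2"
    and f: "\<And>x. (f has_real_derivative f' x) (at x)"
    and g: "\<And>x. (g has_real_derivative g' x) (at x)"
    and h: "\<And>x. (h has_real_derivative h' x) (at x)"
    and m1: "x = x1 \<Longrightarrow> f x1 = g x1 \<and> f' x1 = g' x1"
    and m2: "x = x2 \<Longrightarrow> g x2 = h x2 \<and> g' x2 = h' x2"
  shows "(glue x1 x2 f g h has_real_derivative glue x1 x2 f' g' h' x) (at x)"
proof -
  consider "x < x1" | "x = x1" | "x1 < x" "x < x2" | "x = x2" | "x2 < x" by linarith
  then show ?thesis
  proof cases
    case 1
    then have "(glue x1 x2 f g h has_real_derivative f' x) (at x)"
      by (intro DERIV_transform_open[OF f, of "{..<x1}"]) (auto simp: glue_def)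
    then show ?thesis using 1 by (simp add: glue_def)
  next
    case 2
    have "(glue x1 x2 f g h has_real_derivative g' x1) (at x1)"
      by (rule DERIV_at_corner[of f _ _ g "x1 - 1" _ x2])
        (use f[of x1] g m1 2 \<open>x1 < x2\<close> in \<open>auto simp: glue_def\<close>)
    then show ?thesis using 2 \<open>x1 < x2\<close> by (simp add: glue_def)
  next
    case 3
    then have "(glue x1 x2 f g h has_real_derivative g' x) (at x)"
      by (intro DERIV_transform_open[OF g, of "{x1<..<x2}"]) (auto simp: glue_def)
    then show ?thesis using 3 by (simp add: glue_def)
  next
    case 4
    have "(glue x1 x2 f g h has_real_derivative h' x2) (at x2)"
      by (rule DERIV_at_corner[of g _ _ h x1 _ "x2 + 1"])
        (use g[of x2] h m2 4 \<open>x1 < x2\<close> in \<open>auto simp: glue_def\<close>)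
    then show ?thesis using 4 \<open>x1 < x2\<close> by (simp add: glue_def)
  next
    case 5
    then have "(glue x1 x2 f g h has_real_derivative h' x) (at x)"
      by (intro DERIV_transform_open[OF h, of "{x2<..}"]) (use \<open>x1 < x2\<close> in \<open>auto simp: glue_def\<close>)
    then show ?thesis using 5 \<open>x1 < x2\<close> by (simp add: glue_def)
  qed
qed

text \<open>The glued function is a combination of the three pieces composed with truncations of the argument.\<close>
lemma continuous_on_glue:
  assumes "x1 < x2" "f x1 = g x1" "g x2 = h x2"
    and "continuous_on UNIV f" "continuous_on UNIV g" "continuous_on UNIV h"
  shows "continuous_on A (glue x1 x2 f g h)"
proof -
  have "glue x1 x2 f g h =
      (\<lambda>x. f (min x x1) - g x1 + g (max x1 (min x x2)) - h x2 + h (max x x2))"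
    using assms(1-3) by (auto simp: glue_def fun_eq_iff min_def max_def)
  moreover have "continuous_on A
      (\<lambda>x. f (min x x1) - g x1 + g (max x1 (min x x2)) - h x2 + h (max x x2))"
    by (intro continuous_intros continuous_on_compose2[OF assms(4)]
        continuous_on_compose2[OF assms(5)] continuous_on_compose2[OF assms(6)]) auto
  ultimately show ?thesis by simp
qed

lemma glue_C1_match:
  assumes "x1 < x2"
    and f: "\<And>x. (f has_real_derivative f' x) (at x)"
    and g: "\<And>x. (g has_real_derivative g' x) (at x)"
    and h: "\<And>x. (h has_real_derivative h' x) (at x)"
    and C1: "C1_at (glue x1 x2 f g h) x1" "C1_at (glue x1 x2 f g h) x2"
  shows "f x1 = g x1" "f' x1 = g' x1" "g x2 = h x2" "g' x2 = h' x2"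
    "deriv (glue x1 x2 f g h) x1 = g' x1"
proof -
  have *: "isCont (glue x1 x2 f g h) x1" "glue x1 x2 f g h differentiable (at x1)"
    "isCont (glue x1 x2 f g h) x2" "glue x1 x2 f g h differentiable (at x2)"
    using C1 unfolding C1_at_def by auto
  show "f x1 = g x1" "f' x1 = g' x1" "deriv (glue x1 x2 f g h) x1 = g' x1"
    using DERIV_corner_match[OF *(1,2) f g, of "x1 - 1" x2] \<open>x1 < x2\<close>
    by (auto simp: glue_def)
  show "g x2 = h x2" "g' x2 = h' x2"
    using DERIV_corner_match[OF *(3,4) g h, of "x1" "x2 + 1"] \<open>x1 < x2\<close>
    by (auto simp: glue_def)
qed

lemma DERIV_affine: "((\<lambda>x. - c * x + k) has_real_derivative - c) (at (x::real))"
  by (auto intro!: derivative_eq_intros)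

section \<open>Convexity up to the upper boundary\<close>

text \<open>The pieces of \<open>V\<^sub>3\<close> and \<open>V\<^sub>4\<close> on \<open>[0, x\<^sub>1]\<close> (letter \<open>L\<close>) and on \<open>[x\<^sub>1, x\<^sub>2]\<close> (letter \<open>R\<close>), extended to
solutions on the whole line and described by their equations and matching conditions, from which
all signs are derived. On \<open>[x\<^sub>2, \<infinity>)\<close> the pieces are \<open>-c x + a5\<close> and \<open>-c x + b5\<close>.\<close>
locale free_boundary =
  fixes \<kappa> \<mu> M c l \<delta> x1 x2 a5 b5 :: real
    and L3 L3' L3'' R3 R3' R3'' L4 L4' L4'' R4 R4' R4'' :: "real \<Rightarrow> real"
  assumes \<kappa>: "0 < \<kappa>" and M: "0 < M" and c: "0 < c" "c < 1"
    and l: "0 < l" "l < \<delta>" and x12: "0 < x1" "x1 < x2"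
    and L3: "\<And>x. (L3 has_real_derivative L3' x) (at x)" "\<And>x. (L3' has_real_derivative L3'' x) (at x)"
    and R3: "\<And>x. (R3 has_real_derivative R3' x) (at x)" "\<And>x. (R3' has_real_derivative R3'' x) (at x)"
    and L4: "\<And>x. (L4 has_real_derivative L4' x) (at x)" "\<And>x. (L4' has_real_derivative L4'' x) (at x)"
    and R4: "\<And>x. (R4 has_real_derivative R4' x) (at x)" "\<And>x. (R4' has_real_derivative R4'' x) (at x)"
    and ode_L3: "\<And>x. \<kappa> * L3'' x + (\<mu> + M) * L3' x - \<delta> * L3 x + M = 0"
    and ode_R3: "\<And>x. \<kappa> * R3'' x + \<mu> * R3' x - \<delta> * R3 x = 0"
    and ode_L4: "\<And>x. \<kappa> * L4'' x + (\<mu> + M) * L4' x - \<delta> * L4 x + (l * L3 x + M) = 0"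
    and ode_R4: "\<And>x. \<kappa> * R4'' x + \<mu> * R4' x - \<delta> * R4 x + l * R3 x = 0"
    and at_0: "L3 0 = 0" "L4 0 = 0"
    and at_x1: "L3 x1 = R3 x1" "L3' x1 = R3' x1" "L4 x1 = R4 x1" "L4' x1 = R4' x1" "R4' x1 = -1"
    and at_x2: "R3' x2 = - c" "R4' x2 = - c" "R4'' x2 = 0"
    and a5: "R3 x2 = - c * x2 + a5" and b5: "R4 x2 = - c * x2 + b5"
begin

lemma \<delta>: "0 < \<delta>" using l by simp

lemma third_derivatives:
  "(L3'' has_real_derivative (\<delta> * L3' x - (\<mu> + M) * L3'' x) / \<kappa>) (at x)"
  "(R3'' has_real_derivative (\<delta> * R3' x - \<mu> * R3'' x) / \<kappa>) (at x)"
  "(L4'' has_real_derivative (\<delta> * L4' x - (\<mu> + M) * L4'' x - l * L3' x) / \<kappa>) (at x)"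
  "(R4'' has_real_derivative (\<delta> * R4' x - \<mu> * R4'' x - l * R3' x) / \<kappa>) (at x)"
proof -
  show "(L3'' has_real_derivative (\<delta> * L3' x - (\<mu> + M) * L3'' x) / \<kappa>) (at x)"
    using DERIV_of_ODE[OF _ L3 DERIV_const ode_L3] \<kappa> by simp
  show "(R3'' has_real_derivative (\<delta> * R3' x - \<mu> * R3'' x) / \<kappa>) (at x)"
    using DERIV_of_ODE[OF _ R3 DERIV_const[of 0], of \<kappa> \<mu> \<delta> x] ode_R3 \<kappa> by simp
  show "(L4'' has_real_derivative (\<delta> * L4' x - (\<mu> + M) * L4'' x - l * L3' x) / \<kappa>) (at x)"
    by (rule DERIV_of_ODE[OF _ L4 _ ode_L4]) (use \<kappa> L3 in \<open>auto intro!: derivative_eq_intros\<close>)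
  show "(R4'' has_real_derivative (\<delta> * R4' x - \<mu> * R4'' x - l * R3' x) / \<kappa>) (at x)"
    by (rule DERIV_of_ODE[OF _ R4 _ ode_R4]) (use \<kappa> R3 in \<open>auto intro!: derivative_eq_intros\<close>)
qed

text \<open>This is where \<open>V\<^sub>4'(x\<^sub>1) = -1\<close> enters: the drift term changes by \<open>M V\<^sub>4'(x\<^sub>1) + M = 0\<close>.\<close>
lemma L4''_eq_R4'': "L4'' x1 = R4'' x1"
proof -
  have "\<kappa> * L4'' x1 = \<kappa> * R4'' x1"
    using ode_L4[of x1] ode_R4[of x1] unfolding at_x1 by algebra
  then show ?thesis using \<kappa> by simp
qed

lemma V3''_jump: "\<kappa> * (R3'' x1 - L3'' x1) = M * (L3' x1 + 1)"
  using ode_L3[of x1] ode_R3[of x1] at_x1 by (simp add: algebra_simps)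

lemma sub_V3':
  "subsolution \<kappa> (\<mu> + M) \<delta> S L3' L3''" "subsolution \<kappa> \<mu> \<delta> S R3' R3''"
proof -
  show "subsolution \<kappa> (\<mu> + M) \<delta> S L3' L3''"
    by (rule subsolution_derivative_of_ODE[OF _ L3 DERIV_const ode_L3]) (use \<kappa> in auto)
  show "subsolution \<kappa> \<mu> \<delta> S R3' R3''"
    by (rule subsolution_derivative_of_ODE[OF _ R3 DERIV_const[of 0]]) (use \<kappa> ode_R3 in auto)
qed

text \<open>For \<open>m \<ge> 0\<close> the shift by \<open>m\<close> only helps, and turns the maximum principle into lower bounds
\<open>u \<ge> -m\<close>.\<close>
lemma sub_neg_V3':
  assumes "0 \<le> m"
  shows "subsolution \<kappa> (\<mu> + M) \<delta> S (\<lambda>x. - L3' x - m) (\<lambda>x. - L3'' x)"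
    and "subsolution \<kappa> \<mu> \<delta> S (\<lambda>x. - R3' x - m) (\<lambda>x. - R3'' x)"
proof -
  have "- (\<delta> * m) \<le> 0" using assms \<delta> by simp
  show "subsolution \<kappa> (\<mu> + M) \<delta> S (\<lambda>x. - L3' x - m) (\<lambda>x. - L3'' x)"
  proof (rule subsolution_derivative_of_ODE[where y = "\<lambda>x. - L3 x - m * x"
        and h = "\<lambda>x. (\<mu> + M) * m - M - \<delta> * m * x" and h' = "\<lambda>_. - (\<delta> * m)"])
    show "\<kappa> * - L3'' x + (\<mu> + M) * (- L3' x - m) - \<delta> * (- L3 x - m * x) +
        ((\<mu> + M) * m - M - \<delta> * m * x) = 0" for x
      using ode_L3[of x] by (simp add: algebra_simps)
  qed (use \<kappa> \<open>- (\<delta> * m) \<le> 0\<close> L3 in \<open>auto intro!: derivative_eq_intros\<close>)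
  show "subsolution \<kappa> \<mu> \<delta> S (\<lambda>x. - R3' x - m) (\<lambda>x. - R3'' x)"
  proof (rule subsolution_derivative_of_ODE[where y = "\<lambda>x. - R3 x - m * x"
        and h = "\<lambda>x. \<mu> * m - \<delta> * m * x" and h' = "\<lambda>_. - (\<delta> * m)"])
    show "\<kappa> * - R3'' x + \<mu> * (- R3' x - m) - \<delta> * (- R3 x - m * x) +
        (\<mu> * m - \<delta> * m * x) = 0" for x
      using ode_R3[of x] by (simp add: algebra_simps)
  qed (use \<kappa> \<open>- (\<delta> * m) \<le> 0\<close> R3 in \<open>auto intro!: derivative_eq_intros\<close>)
qed

lemma ode_gap:
  "\<kappa> * (L4'' x - L3'' x) + (\<mu> + M) * (L4' x - L3' x) - \<delta> * (L4 x - L3 x) + l * L3 x = 0"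
  "\<kappa> * (R4'' x - R3'' x) + \<mu> * (R4' x - R3' x) - \<delta> * (R4 x - R3 x) + l * R3 x = 0"
  using ode_L3[of x] ode_L4[of x] ode_R3[of x] ode_R4[of x]
  by (simp_all add: right_diff_distrib)

lemma sub_gap:
  "(\<And>x. x \<in> S \<Longrightarrow> L3 x \<le> 0) \<Longrightarrow>
    subsolution \<kappa> (\<mu> + M) \<delta> S (\<lambda>x. L4 x - L3 x) (\<lambda>x. L4' x - L3' x)"
  "(\<And>x. x \<in> S \<Longrightarrow> R3 x \<le> 0) \<Longrightarrow>
    subsolution \<kappa> \<mu> \<delta> S (\<lambda>x. R4 x - R3 x) (\<lambda>x. R4' x - R3' x)"
  using l
  by (auto intro!: subsolution_of_ODE[OF _ _ ode_gap(1)] subsolution_of_ODE[OF _ _ ode_gap(2)]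
      DERIV_diff L3 L4 R3 R4 simp: mult_le_0_iff)

lemma sub_gap':
  "(\<And>x. x \<in> S \<Longrightarrow> L3' x \<le> 0) \<Longrightarrow>
    subsolution \<kappa> (\<mu> + M) \<delta> S (\<lambda>x. L4' x - L3' x) (\<lambda>x. L4'' x - L3'' x)"
  "(\<And>x. x \<in> S \<Longrightarrow> R3' x \<le> 0) \<Longrightarrow>
    subsolution \<kappa> \<mu> \<delta> S (\<lambda>x. R4' x - R3' x) (\<lambda>x. R4'' x - R3'' x)"
  using l \<kappa>
  by (auto intro!: subsolution_derivative_of_ODE[OF _ _ _ _ ode_gap(1)]
      subsolution_derivative_of_ODE[OF _ _ _ _ ode_gap(2)]
      DERIV_diff DERIV_cmult L3 L4 R3 R4 simp: mult_le_0_iff)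

text \<open>Both \<open>u\<close> and \<open>v - u\<close> are nonpositive at the two ends of \<open>[x\<^sub>1, x\<^sub>2]\<close>, the latter because \<open>v\<close> equals
\<open>-1\<close> at \<open>x\<^sub>1\<close> and because \<open>u\<close> and \<open>v\<close> both equal \<open>-c\<close> at \<open>x\<^sub>2\<close>.\<close>
lemma gap'_R_nonpos:
  assumes "R3' x1 \<le> 0" "R4' x1 \<le> R3' x1" "x \<in> {x1..x2}"
  shows "R3' x \<le> 0" "R4' x \<le> R3' x"
proof -
  have u: "R3' y \<le> 0" if "y \<in> {x1..x2}" for y
    using subsolution_nonpos_between[OF sub_V3'(2) \<kappa> \<delta> assms(1) _ that] at_x2 c by simp
  then show "R3' x \<le> 0" using assms(3) by blast
  have "R4' x - R3' x \<le> 0"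
    by (rule subsolution_nonpos_between[OF sub_gap'(2) \<kappa> \<delta> _ _ assms(3)])
      (use u assms at_x1 at_x2 in auto)
  then show "R4' x \<le> R3' x" by simp
qed

lemma forcing_dominates_of_gap'_nonpos:
  assumes "v \<le> u" "u \<le> 0" "v < 0"
  shows "\<delta> * v < l * u"
proof (cases "u = 0")
  case True then show ?thesis using assms \<delta> by (simp add: mult_less_0_iff)
next
  case False
  then have "\<delta> * u < l * u" using assms l by simp
  moreover have "\<delta> * v \<le> \<delta> * u" using assms \<delta> by simp
  ultimately show ?thesis by simp
qed

text \<open>In each step a wrong sign at \<open>x\<^sub>1\<close> or at \<open>0\<close> is carried by the maximum principle to \<open>x\<^sub>2\<close>, where
it contradicts \<open>u = v = -c\<close>. The slopes of \<open>u\<close> and of \<open>v - u\<close> jump at \<open>x\<^sub>1\<close>; when either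
function is carried across \<open>x\<^sub>1\<close>, the jump has the sign that steepens its climb.\<close>
lemma decreasing_start:
  assumes neg0: "L3' 0 < 0"
  shows "x \<in> {0..x1} \<Longrightarrow> L3' x \<le> 0 \<and> L4' x \<le> L3' x"
    and "x \<in> {x1..x2} \<Longrightarrow> R3' x \<le> 0 \<and> R4' x \<le> R3' x"
proof -
  \<comment> \<open>If \<open>u(x\<^sub>1) \<ge> 0\<close>, then \<open>u\<close> reaches \<open>x\<^sub>1\<close> with nonnegative slope, which jumps up, and \<open>u\<close> rises to \<open>x\<^sub>2\<close>.\<close>
  have ux1: "L3' x1 < 0"
  proof (rule ccontr)
    assume "\<not> L3' x1 < 0"
    then have ge: "0 \<le> L3' x1" by simp
    have "0 \<le> L3'' x1"
      using subsolution_rises_leftwards[OF sub_V3'(1) \<kappa> \<delta> x12(1) ge] neg0 ge by force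
    moreover have "0 < \<kappa> * (R3'' x1 - L3'' x1)" unfolding V3''_jump using M ge by simp
    then have "L3'' x1 < R3'' x1" using \<kappa> by (simp add: zero_less_mult_iff)
    ultimately have "R3' x1 < R3' x2"
      using subsolution_rises_rightwards(1)[OF sub_V3'(2) \<kappa> \<delta> x12(2)] ge at_x1 by simp
    then show False using at_x1 at_x2 ge c by simp
  qed
  have uL: "L3' y \<le> 0" if "y \<in> {0..x1}" for y
    using subsolution_nonpos_between[OF sub_V3'(1) \<kappa> \<delta> _ _ that] neg0 ux1 by simp
  have uR: "R3' y \<le> 0" if "y \<in> {x1..x2}" for y
    using subsolution_nonpos_between[OF sub_V3'(2) \<kappa> \<delta> _ _ that] ux1 at_x1 at_x2 c by simp
  have L3neg: "L3 y \<le> 0" if "y \<in> {0..x1}" for y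
    using DERIV_nonpos_imp_nonincreasing[of 0 y L3] L3(1) uL that at_0 by force
  have R3neg: "R3 y \<le> 0" if "y \<in> {x1..x2}" for y
    using DERIV_nonpos_imp_nonincreasing[of x1 y R3] R3(1) uR that at_x1 L3neg[of x1] x12 by force
  \<comment> \<open>Otherwise the gap \<open>V\<^sub>4 - V\<^sub>3\<close> starts from \<open>0\<close> and rises up to \<open>x\<^sub>2\<close>, with positive slope there.\<close>
  have k0: "L4' 0 \<le> L3' 0"
  proof (rule ccontr)
    assume "\<not> L4' 0 \<le> L3' 0"
    then have k: "0 < L4' 0 - L3' 0" by simp
    have "L4 0 - L3 0 < L4 x1 - L3 x1" "0 < L4' x1 - L3' x1"
      by (rule subsolution_rises_rightwards[OF sub_gap(1) \<kappa> \<delta> x12(1)];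
          use k at_0 L3neg in simp)+
    then have "0 < R4' x2 - R3' x2"
      by (intro subsolution_rises_rightwards(2)[OF sub_gap(2) \<kappa> \<delta> x12(2)])
        (use at_0 at_x1 R3neg in auto)
    then show False using at_x2 by simp
  qed
  \<comment> \<open>Otherwise \<open>u(x\<^sub>1) < v(x\<^sub>1) = -1\<close>, so \<open>u'\<close> jumps down and \<open>(v - u)'\<close> jumps up at \<open>x\<^sub>1\<close>.\<close>
  have kx1: "L4' x1 \<le> L3' x1"
  proof (rule ccontr)
    assume "\<not> L4' x1 \<le> L3' x1"
    then have k: "0 < L4' x1 - L3' x1" by simp
    have "0 < L4'' x1 - L3'' x1"
      using subsolution_rises_leftwards[OF sub_gap'(1) \<kappa> \<delta> x12(1)] uL k k0 by force
    moreover have "\<kappa> * (R3'' x1 - L3'' x1) < 0"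
      unfolding V3''_jump using M k at_x1 by (simp add: mult_less_0_iff)
    then have "R3'' x1 < L3'' x1" using \<kappa> by (simp add: mult_less_0_iff)
    ultimately have "R4' x1 - R3' x1 < R4' x2 - R3' x2"
      by (intro subsolution_rises_rightwards(1)[OF sub_gap'(2) \<kappa> \<delta> x12(2)])
        (use k at_x1 uR L4''_eq_R4'' in auto)
    then show False using k at_x1 at_x2 by simp
  qed
  show "L3' x \<le> 0 \<and> L4' x \<le> L3' x" if "x \<in> {0..x1}"
    using subsolution_nonpos_between[OF sub_gap'(1) \<kappa> \<delta> _ _ that] uL k0 kx1 that by simp
  show "R3' x \<le> 0 \<and> R4' x \<le> R3' x" if "x \<in> {x1..x2}"
    using gap'_R_nonpos[OF _ _ that] ux1 kx1 at_x1 by simp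
qed

text \<open>If \<open>u(x\<^sub>1) \<le> -1\<close>, then \<open>u\<close> arrives at \<open>x\<^sub>1\<close> without increasing, the jump of \<open>u'\<close> is not positive,
and \<open>u\<close> stays below \<open>-1\<close>, which contradicts \<open>u(x\<^sub>2) = -c > -1\<close>. The other bounds are the maximum
principle between the ends of the two intervals.\<close>
lemma increasing_start:
  assumes nonneg0: "0 \<le> L3' 0"
  shows "x \<in> {0..x1} \<Longrightarrow> - 1 \<le> L3' x"
    and "x \<in> {x1..x2} \<Longrightarrow> - c \<le> R3' x \<or> R3' x \<le> 0 \<and> R4' x \<le> R3' x"
proof -
  have ux1: "- 1 < L3' x1"
  proof (rule ccontr)
    assume "\<not> - 1 < L3' x1"
    then have le: "L3' x1 \<le> - 1" by simp
    have "L3'' x1 \<le> 0"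
      using subsolution_rises_leftwards[OF sub_neg_V3'(1)[of 0] \<kappa> \<delta> x12(1)] le nonneg0 by force
    moreover have "\<kappa> * (R3'' x1 - L3'' x1) \<le> 0"
      unfolding V3''_jump using M le by (simp add: mult_le_0_iff)
    then have "R3'' x1 \<le> L3'' x1" using \<kappa> by (simp add: mult_le_0_iff)
    ultimately have "- R3' x1 < - R3' x2"
      using subsolution_rises_rightwards(1)[OF sub_neg_V3'(2)[of 0] \<kappa> \<delta> x12(2)] le at_x1 by simp
    then show False using at_x1 at_x2 le c by simp
  qed
  show "- 1 \<le> L3' x" if "x \<in> {0..x1}"
    using subsolution_nonpos_between[OF sub_neg_V3'(1)[of 1] \<kappa> \<delta> _ _ that] nonneg0 ux1 by simp
  show "- c \<le> R3' x \<or> R3' x \<le> 0 \<and> R4' x \<le> R3' x" if "x \<in> {x1..x2}"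
  proof (cases "- c \<le> R3' x1")
    case True
    then show ?thesis
      using subsolution_nonpos_between[OF sub_neg_V3'(2)[of c] \<kappa> \<delta> _ _ that] at_x2 c by simp
  next
    case False
    then show ?thesis using gap'_R_nonpos[OF _ _ that] ux1 at_x1 c by simp
  qed
qed

text \<open>The inequality that excludes a last zero of \<open>v'\<close>. When \<open>u\<close> is bounded below by the level under
which \<open>v\<close> lies, it follows from \<open>\<lambda> < \<delta>\<close> directly.\<close>
lemma forcing_dominates:
  shows "x \<in> {0..x1} \<Longrightarrow> L4' x < - 1 \<Longrightarrow> \<delta> * L4' x < l * L3' x"
    and "x \<in> {x1..x2} \<Longrightarrow> R4' x < - c \<Longrightarrow> \<delta> * R4' x < l * R3' x"
proof -
  have scaled: "\<delta> * v < l * u" if "v < - m" "- m \<le> u" "0 < m" for u v m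
  proof -
    have "\<delta> * v < \<delta> * (- m)" using that(1) \<delta> by (rule mult_strict_left_mono)
    also have "\<dots> \<le> l * (- m)" using l that by simp
    also have "\<dots> \<le> l * u" using l that by (intro mult_left_mono) auto
    finally show ?thesis .
  qed
  show "\<delta> * L4' x < l * L3' x" if "x \<in> {0..x1}" "L4' x < - 1"
  proof (cases "L3' 0 < 0")
    case True
    then show ?thesis
      using decreasing_start(1)[OF True that(1)] that(2)
      by (intro forcing_dominates_of_gap'_nonpos) auto
  next
    case False
    then show ?thesis using scaled[of "L4' x" 1 "L3' x"] increasing_start(1) that by simp
  qed
  show "\<delta> * R4' x < l * R3' x" if "x \<in> {x1..x2}" "R4' x < - c"
  proof (cases "L3' 0 < 0")
    case True
    then show ?thesis
      using decreasing_start(2)[OF True that(1)] that(2) c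
      by (intro forcing_dominates_of_gap'_nonpos) auto
  next
    case False
    then have "- c \<le> R3' x \<or> R3' x \<le> 0 \<and> R4' x \<le> R3' x"
      using increasing_start(2)[OF _ that(1)] by simp
    then show ?thesis
      using scaled[of "R4' x" c "R3' x"] forcing_dominates_of_gap'_nonpos[of "R4' x" "R3' x"] that c
      by auto
  qed
qed

text \<open>At \<open>x\<^sub>2\<close> itself \<open>v' = 0\<close>, so positivity starts from \<open>\<kappa>v''(x\<^sub>2) = -(\<delta> - \<lambda>)c < 0\<close>.\<close>
lemma R4''_pos:
  assumes "x1 \<le> x" "x < x2"
  shows "0 < R4'' x"
proof (rule positive_up_to_right_end[OF third_derivatives(4) _ _ assms])
  have "(\<delta> * R4' x2 - \<mu> * R4'' x2 - l * R3' x2) / \<kappa> < 0"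
    using at_x2 l c \<kappa> by (simp add: divide_less_0_iff)
  then obtain e where "e > 0" and e: "\<And>h. 0 < h \<Longrightarrow> h < e \<Longrightarrow> R4'' x2 < R4'' (x2 - h)"
    using DERIV_neg_dec_left[OF third_derivatives(4)[of x2]] by auto
  have "eventually (\<lambda>x. x \<in> {x2 - e<..<x2}) (at_left x2)"
    using eventually_at_left_real[of "x2 - e" x2] \<open>e > 0\<close> by simp
  then show "eventually (\<lambda>x. 0 < R4'' x) (at_left x2)"
  proof eventually_elim
    case (elim x)
    then show ?case using e[of "x2 - x"] at_x2 by simp
  qed
next
  fix z assume z: "x1 \<le> z" "z < x2" "R4'' z = 0" and pos: "\<And>x. z < x \<Longrightarrow> x < x2 \<Longrightarrow> 0 < R4'' x"
  have "R4' z < - c"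
    using has_real_derivative_pos_imp_less[OF R4(2) z(2) pos] at_x2 by simp
  then show "(\<delta> * R4' z - \<mu> * R4'' z - l * R3' z) / \<kappa> < 0"
    using forcing_dominates(2)[of z] z \<kappa> by (simp add: divide_less_0_iff)
qed

lemma L4''_pos:
  assumes "0 \<le> x" "x \<le> x1"
  shows "0 < L4'' x"
proof (cases "x = x1")
  case True
  then show ?thesis using L4''_eq_R4'' R4''_pos[of x1] x12 by simp
next
  case False
  show ?thesis
  proof (rule positive_up_to_right_end[OF third_derivatives(3) _ _ assms(1)])
    have "isCont L4'' x1" using third_derivatives(3) by (rule DERIV_isCont)
    moreover have "0 < L4'' x1" using L4''_eq_R4'' R4''_pos[of x1] x12 by simp
    ultimately show "eventually (\<lambda>x. 0 < L4'' x) (at_left x1)"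
      by (metis isCont_def filterlim_at_split order_tendstoD(1))
    fix z assume z: "0 \<le> z" "z < x1" "L4'' z = 0" and pos: "\<And>x. z < x \<Longrightarrow> x < x1 \<Longrightarrow> 0 < L4'' x"
    have "L4' z < - 1"
      using has_real_derivative_pos_imp_less[OF L4(2) z(2) pos] at_x1 by simp
    then show "(\<delta> * L4' z - (\<mu> + M) * L4'' z - l * L3' z) / \<kappa> < 0"
      using forcing_dominates(1)[of z] z \<kappa> by (simp add: divide_less_0_iff)
  next
    show "x < x1" using False assms by simp
  qed
qed

lemma L4'_less: "0 \<le> x \<Longrightarrow> x < x1 \<Longrightarrow> L4' x < - 1"
  using has_real_derivative_pos_imp_less[OF L4(2), of x x1] L4''_pos at_x1 by simp

lemma R4'_less: "x1 \<le> x \<Longrightarrow> x < x2 \<Longrightarrow> R4' x < - c"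
  using has_real_derivative_pos_imp_less[OF R4(2), of x x2] R4''_pos at_x2 by simp

lemma R4'_ge: "x1 \<le> x \<Longrightarrow> x < x2 \<Longrightarrow> - 1 \<le> R4' x"
  using has_real_derivative_pos_imp_less[OF R4(2), of x1 x] R4''_pos at_x1
  by (cases "x = x1") force+

section \<open>Verification of the extended system\<close>

definition V3 where "V3 = glue x1 x2 L3 R3 (\<lambda>x. - c * x + a5)"
definition V3' where "V3' = glue x1 x2 L3' R3' (\<lambda>_. - c)"
text \<open>The conditions on \<open>f\<^sub>x\<^sub>x\<close> prescribe the right limit of \<open>V\<^sub>3''\<close> at \<open>x\<^sub>1\<close> and the left limit at \<open>x\<^sub>2\<close>;
hence \<open>x \<le> x2\<close>, unlike in the glued functions.\<close>
definition V3'' where "V3'' x = (if x < x1 then L3'' x else if x \<le> x2 then R3'' x else 0)"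
definition V4 where "V4 = glue x1 x2 L4 R4 (\<lambda>x. - c * x + b5)"
definition V4' where "V4' = glue x1 x2 L4' R4' (\<lambda>_. - c)"
definition V4'' where "V4'' = glue x1 x2 L4'' R4'' (\<lambda>_. 0)"

lemma DERIV_V3: "(V3 has_real_derivative V3' x) (at x)"
  unfolding V3_def V3'_def
  by (rule DERIV_glue) (use x12 L3(1) R3(1) DERIV_affine at_x1 at_x2 a5 in auto)

lemma DERIV_V4: "(V4 has_real_derivative V4' x) (at x)"
  unfolding V4_def V4'_def
  by (rule DERIV_glue) (use x12 L4(1) R4(1) DERIV_affine at_x1 at_x2 b5 in auto)

lemma DERIV_V4': "(V4' has_real_derivative V4'' x) (at x)"
  unfolding V4'_def V4''_def
  by (rule DERIV_glue) (use x12 L4(2) R4(2) at_x1 at_x2 L4''_eq_R4'' in auto)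

lemma DERIV_V3':
  assumes "x \<noteq> x1" "x \<noteq> x2"
  shows "(V3' has_real_derivative V3'' x) (at x)"
proof -
  have "(V3' has_real_derivative glue x1 x2 L3'' R3'' (\<lambda>_. 0) x) (at x)"
    unfolding V3'_def by (rule DERIV_glue) (use x12 L3(2) R3(2) assms in auto)
  moreover have "glue x1 x2 L3'' R3'' (\<lambda>_. 0) x = V3'' x"
    using assms by (auto simp: glue_def V3''_def)
  ultimately show ?thesis by simp
qed

lemma continuous_V:
  "continuous_on A V3" "continuous_on A V3'" "continuous_on A V4" "continuous_on A V4'"
proof -
  have L: "continuous_on A L3'" and R: "continuous_on A R3'" for A
    using L3(2) R3(2) by (meson DERIV_continuous_on has_field_derivative_at_within)+
  show "continuous_on A V3'"
    unfolding V3'_def by (rule continuous_on_glue) (use L R x12 at_x1 at_x2 in auto)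
  show "continuous_on A V3" "continuous_on A V4" "continuous_on A V4'"
    using DERIV_V3 DERIV_V4 DERIV_V4'
    by (meson DERIV_continuous_on has_field_derivative_at_within)+
qed

lemma V4''_nonneg: "0 \<le> x \<Longrightarrow> 0 \<le> V4'' x"
  using L4''_pos[of x] R4''_pos[of x] by (auto simp: V4''_def glue_def)

lemma V4'_less: "0 \<le> x \<Longrightarrow> x < x2 \<Longrightarrow> V4' x < - c"
  using L4'_less[of x] R4'_less[of x] c by (auto simp: V4'_def glue_def)

lemma V4'_eq: "x2 \<le> x \<Longrightarrow> V4' x = - c"
  using x12 by (auto simp: V4'_def glue_def)

lemma V4'_le: "0 \<le> x \<Longrightarrow> V4' x \<le> - c"
  using V4'_less[of x] V4'_eq[of x] by force

lemma V4'_threshold: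
  "0 \<le> x \<Longrightarrow> x < x1 \<Longrightarrow> V4' x \<le> - 1" "x1 \<le> x \<Longrightarrow> - 1 \<le> V4' x"
  using L4'_less[of x] R4'_ge[of x] c x12 by (auto simp: V4'_def glue_def)

lemma V3_equation:
  assumes "x \<le> x2"
  shows "\<kappa> * V3'' x + (\<mu> + Pi_hat M x1 x t) * V3' x - \<delta> * V3 x + Pi_hat M x1 x t = 0"
  using ode_L3[of x] ode_R3[of x] at_x2 a5 x12 assms
  by (auto simp: V3''_def V3'_def V3_def glue_def Pi_hat_def less_le)

lemma V4_equation:
  assumes "x \<le> x2"
  shows "\<kappa> * V4'' x + (\<mu> + Pi_hat M x1 x t) * V4' x - \<delta> * V4 x + l * V3 x + Pi_hat M x1 x t = 0"
  using ode_L4[of x] ode_R4[of x] at_x2 a5 b5 x12 assms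
  by (auto simp: V4''_def V4'_def V4_def V3_def glue_def Pi_hat_def less_le add.assoc)

text \<open>Beyond \<open>x\<^sub>2\<close> the left-hand side of the equation is affine in \<open>x\<close> with slope \<open>(\<delta> - \<lambda>)c\<close>, and it
vanishes at \<open>x\<^sub>2\<close> since \<open>V\<^sub>4''(x\<^sub>2) = 0\<close>.\<close>
lemma V4_inequality:
  assumes "x2 \<le> x"
  shows "0 \<le> \<kappa> * V4'' x + (\<mu> + Pi_hat M x1 x t) * V4' x - \<delta> * V4 x + l * V3 x + Pi_hat M x1 x t"
proof -
  have x: "\<not> x < x1" "\<not> x < x2" using assms x12 by auto
  have "- \<mu> * c - \<delta> * (- c * x2 + b5) + l * (- c * x2 + a5) = 0"
    using ode_R4[of x2] at_x2 a5 b5 by simp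
  moreover have "0 \<le> (\<delta> - l) * c * (x - x2)" using l c assms by simp
  ultimately have "0 \<le> - \<mu> * c - \<delta> * (- c * x + b5) + l * (- c * x + a5)"
    by (simp add: algebra_simps)
  then show ?thesis using x by (simp add: V4''_def V4'_def V4_def V3_def glue_def Pi_hat_def)
qed

lemma V_at_0: "V3 0 = 0" "V4 0 = 0"
  using at_0 x12 by (simp_all add: V3_def V4_def glue_def)

definition f where "f x t s = exp (- \<delta> * (t - s)) * (l * (t - s) * V3 x + V4 x)"
definition fx where "fx x t s = exp (- \<delta> * (t - s)) * (l * (t - s) * V3' x + V4' x)"
definition ft where
  "ft x t s = exp (- \<delta> * (t - s)) * (l * V3 x - \<delta> * (l * (t - s) * V3 x + V4 x))"
definition fxx where "fxx x t s = exp (- \<delta> * (t - s)) * (l * (t - s) * V3'' x + V4'' x)"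

lemma has_derivative_f:
  "((\<lambda>(x, t, s). f x t s) has_derivative
      (\<lambda>(h, k, j). fx x t s * h + ft x t s * k + - ft x t s * j)) (at (x, t, s) within S)"
proof -
  have V: "((\<lambda>p. V3 (fst p)) has_derivative (\<lambda>q. V3' x * fst q)) (at (x, t, s) within S)"
    "((\<lambda>p. V4 (fst p)) has_derivative (\<lambda>q. V4' x * fst q)) (at (x, t, s) within S)"
    using has_derivative_compose[OF has_derivative_fst[OF has_derivative_ident], of V3 "(*) (V3' x)" "(x, t, s)"]
      has_derivative_compose[OF has_derivative_fst[OF has_derivative_ident], of V4 "(*) (V4' x)" "(x, t, s)"]
      DERIV_V3[of x] DERIV_V4[of x]
    unfolding has_field_derivative_def by simp_all
  show ?thesis
    unfolding f_def fx_def ft_def case_prod_beta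
    by (rule derivative_eq_intros V refl | simp)+ (auto simp: algebra_simps)
qed

lemma f_derivs_f: "f_derivs x1 x2 f fx ft (\<lambda>x t s. - ft x t s) fxx"
  unfolding f_derivs_def
proof (intro conjI allI impI)
  have V: "continuous_on A (\<lambda>p. V3 (fst p))" "continuous_on A (\<lambda>p. V3' (fst p))"
    "continuous_on A (\<lambda>p. V4 (fst p))" "continuous_on A (\<lambda>p. V4' (fst p))"
    for A :: "(real \<times> real \<times> real) set"
    by (auto intro!: continuous_on_compose2[OF continuous_V(1)[of UNIV]]
        continuous_on_compose2[OF continuous_V(2)[of UNIV]]
        continuous_on_compose2[OF continuous_V(3)[of UNIV]]
        continuous_on_compose2[OF continuous_V(4)[of UNIV]] continuous_intros)
  show "\<forall>(x, t, s)\<in>state_time_init. ((\<lambda>(x, t, s). f x t s) has_derivative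
      (\<lambda>(h, k, l). fx x t s * h + ft x t s * k + - ft x t s * l)) (at (x, t, s) within state_time_init)"
    using has_derivative_f by blast
  show "continuous_on state_time_init (\<lambda>(x, t, s). fx x t s)"
    unfolding fx_def case_prod_beta by (intro continuous_intros V)
  show "continuous_on state_time_init (\<lambda>(x, t, s). ft x t s)"
    unfolding ft_def case_prod_beta by (intro continuous_intros V)
  then show "continuous_on state_time_init (\<lambda>(x, t, s). - ft x t s)"
    unfolding case_prod_beta by (intro continuous_intros)
  have "((\<lambda>y. fx y t s) has_real_derivative fxx x t s) (at x)"
    if "x \<noteq> x1" "x \<noteq> x2" for x t s
    unfolding fx_def fxx_def using DERIV_V3'[OF that] DERIV_V4'[of x]
    by (auto intro!: derivative_eq_intros)
  then show "\<forall>(x, t, s)\<in>state_time_init. x \<noteq> x1 \<and> x \<noteq> x2 \<longrightarrow>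
       ((\<lambda>y. fx y t s) has_real_derivative fxx x t s) (at x within {0..})"
    using has_field_derivative_at_within by blast
  \<comment> \<open>On \<open>[x\<^sub>1, x\<^sub>2]\<close>, ends included, \<open>f\<^sub>x\<^sub>x\<close> is given by the continuous middle piece.\<close>
  define g where "g x t s = exp (- \<delta> * (t - s)) * (l * (t - s) * R3'' x + R4'' x)" for x t s
  have fxx_g: "fxx x t s = g x t s" if "x1 \<le> x" "x \<le> x2" for x t s
    using that at_x2 x12 by (auto simp: fxx_def g_def V3''_def V4''_def glue_def less_le)
  have lim: "((\<lambda>y. g y t s) \<longlongrightarrow> g x t s) (at x within A)" for x t s A
    unfolding g_def
    using third_derivatives(2,4)
    by (intro tendsto_intros) (meson DERIV_isCont continuous_at_imp_continuous_at_within continuous_within)+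
  fix t s
  have "eventually (\<lambda>y. g y t s = fxx y t s) (at_right x1)"
    using eventually_at_right_real[OF x12(2)] by eventually_elim (use fxx_g in auto)
  then show "((\<lambda>y. fxx y t s) \<longlongrightarrow> fxx x1 t s) (at_right x1)"
    using Lim_transform_eventually[OF lim] fxx_g[of x1] x12 by simp
  have "eventually (\<lambda>y. g y t s = fxx y t s) (at_left x2)"
    using eventually_at_left_real[OF x12(2)] by eventually_elim (use fxx_g in auto)
  then show "((\<lambda>y. fxx y t s) \<longlongrightarrow> fxx x2 t s) (at_left x2)"
    using Lim_transform_eventually[OF lim] fxx_g[of x2] x12 by simp
qed

text \<open>The term \<open>\<lambda>V\<^sub>3\<close> from differentiating \<open>\<lambda>(t - s)\<close> is the forcing in the equation for \<open>V\<^sub>4\<close>, and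
\<open>\<beta>\<Pi>\<close> splits into \<open>\<lambda>(t - s)\<Pi>\<close> and \<open>\<Pi>\<close>, the inhomogeneities of the two equations.\<close>
lemma f_equation:
  assumes "x \<le> x2"
  shows "ft x t s + (\<mu> + Pi_hat M x1 x t) * fx x t s + \<kappa> * fxx x t s
    + (1 + l * (t - s)) * exp (- \<delta> * (t - s)) * Pi_hat M x1 x t = 0"
proof -
  define p where "p = Pi_hat M x1 x t"
  define e3 where "e3 = \<kappa> * V3'' x + (\<mu> + p) * V3' x - \<delta> * V3 x + p"
  define e4 where "e4 = \<kappa> * V4'' x + (\<mu> + p) * V4' x - \<delta> * V4 x + l * V3 x + p"
  have "ft x t s + (\<mu> + p) * fx x t s + \<kappa> * fxx x t s
      + (1 + l * (t - s)) * exp (- \<delta> * (t - s)) * p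
    = exp (- \<delta> * (t - s)) * (l * (t - s) * e3 + e4)"
    unfolding ft_def fx_def fxx_def e3_def e4_def by algebra
  also have "\<dots> = 0"
    using V3_equation[OF assms, of t] V4_equation[OF assms, of t]
    by (simp add: e3_def e4_def p_def)
  finally show ?thesis unfolding p_def .
qed

theorem extended_HJB_solution_f:
  assumes "\<sigma>\<^sup>2 / 2 = \<kappa>"
  shows "extended_HJB_solution \<mu> \<sigma> M c (\<lambda>t. (1 + l * t) * exp (- \<delta> * t)) x1 x2 f (\<lambda>x t. V4 x)"
  unfolding extended_HJB_solution_def Let_def
proof (intro exI conjI)
  have \<sigma>: "1 / 2 * \<sigma>\<^sup>2 = \<kappa>" using assms by simp
  show "V_derivs (\<lambda>x t. V4 x) (\<lambda>x t. 0) (\<lambda>x t. V4' x) (\<lambda>x t. V4'' x)"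
    unfolding V_derivs_def using DERIV_V4 DERIV_V4'
    by (auto intro: has_field_derivative_at_within)
  show "f_derivs x1 x2 f fx ft (\<lambda>x t s. - ft x t s) fxx" by (rule f_derivs_f)
  have diag: "- ft x t t = \<delta> * V4 x - l * V3 x" for x t by (simp add: ft_def)
  show "\<forall>(x, t)\<in>state_time. is_arg_min
      (\<lambda>u. 0 + (\<mu> + u) * V4' x + 1 / 2 * \<sigma>\<^sup>2 * V4'' x + u - - ft x t t)
      (\<lambda>u. u \<in> {0..M}) (Pi_hat M x1 x t)"
  proof clarify
    fix x t :: real assume "(x, t) \<in> state_time"
    then have x: "0 \<le> x" by (simp add: state_time_def)
    \<comment> \<open>The objective is affine in \<open>u\<close> with slope \<open>V\<^sub>4' + 1\<close>, which changes sign at \<open>x\<^sub>1\<close>.\<close>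
    have "Pi_hat M x1 x t * (V4' x + 1) \<le> u * (V4' x + 1)" if "u \<in> {0..M}" for u
      using V4'_threshold[of x] that x M
      by (auto simp: Pi_hat_def intro: mult_right_mono_neg mult_nonneg_nonneg)
    then show "is_arg_min (\<lambda>u. 0 + (\<mu> + u) * V4' x + 1 / 2 * \<sigma>\<^sup>2 * V4'' x + u - - ft x t t)
        (\<lambda>u. u \<in> {0..M}) (Pi_hat M x1 x t)"
      using M by (force simp: is_arg_min_def algebra_simps Pi_hat_def)
  qed
  show "\<forall>(x, t)\<in>state_time. min
      (0 + (\<mu> + Pi_hat M x1 x t) * V4' x + 1 / 2 * \<sigma>\<^sup>2 * V4'' x + Pi_hat M x1 x t - - ft x t t)
      (- c - V4' x) = 0"
  proof clarify
    fix x t :: real assume "(x, t) \<in> state_time"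
    then have x: "0 \<le> x" by (simp add: state_time_def)
    show "min (0 + (\<mu> + Pi_hat M x1 x t) * V4' x + 1 / 2 * \<sigma>\<^sup>2 * V4'' x + Pi_hat M x1 x t - - ft x t t)
        (- c - V4' x) = 0"
      unfolding \<sigma> diag
      using V4_equation[of x t] V4_inequality[of x t] V4'_le[OF x] V4'_eq[of x]
      by (cases "x \<le> x2") auto
  qed
  show "\<forall>t\<ge>0. V4 0 = 0" using V_at_0 by simp
  \<comment> \<open>The closure stays in the region \<open>x \<le> x2\<close>, where the equation for \<open>f\<close> holds.\<close>
  have "closure {(x, t) \<in> state_time. - c - V4' x > 0} \<subseteq> {..x2} \<times> UNIV"
  proof (rule closure_minimal)
    show "{(x, t) \<in> state_time. - c - V4' x > 0} \<subseteq> {..x2} \<times> UNIV"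
      using V4'_eq by (auto simp: not_le intro: ccontr)
  qed (simp add: closed_Times)
  then show "\<forall>(x, t)\<in>closure {(x, t) \<in> state_time. - c - V4' x > 0}. \<forall>s\<in>{0..t}.
      ft x t s + (\<mu> + Pi_hat M x1 x t) * fx x t s + 1 / 2 * \<sigma>\<^sup>2 * fxx x t s +
      (1 + l * (t - s)) * exp (- \<delta> * (t - s)) * Pi_hat M x1 x t = 0"
    unfolding \<sigma> using f_equation by fastforce
  show "\<forall>(x, t)\<in>{(x, t) \<in> state_time. - c - V4' x = 0}. \<forall>s\<in>{0..t}.
      - ((1 + l * (t - s)) * exp (- \<delta> * (t - s))) * c - fx x t s = 0"
  proof clarify
    fix x t s :: real assume "(x, t) \<in> state_time" "- c - V4' x = 0"
    then have "x2 \<le> x" using V4'_less[of x] by (force simp: state_time_def)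
    then have "V3' x = - c" "V4' x = - c" using x12 by (auto simp: V3'_def V4'_def glue_def)
    then show "- ((1 + l * (t - s)) * exp (- \<delta> * (t - s))) * c - fx x t s = 0"
      by (simp add: fx_def algebra_simps)
  qed
  show "\<forall>t\<ge>0. \<forall>s\<in>{0..t}. f 0 t s = 0" by (simp add: f_def V_at_0)
qed

lemma strict_antimono_V4: "strict_antimono_on {0..} V4"
proof (rule monotone_onI)
  fix x y :: real assume "x \<in> {0..}" "y \<in> {0..}" "x < y"
  moreover have "V4' z < 0" if "x \<le> z" for z
    using V4'_le[of z] c \<open>x \<in> {0..}\<close> that by simp
  ultimately show "V4 y < V4 x"
    using DERIV_V4 by (blast intro: DERIV_neg_imp_decreasing)
qed

lemma convex_V4: "convex_on {0..} V4"
  by (rule f''_ge0_imp_convex[OF _ DERIV_V4 DERIV_V4' V4''_nonneg]) auto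

end

section \<open>The explicit solutions\<close>

text \<open>The general solution of the equations, with a constant forcing and forcing by the exponentials of
the homogeneous equation; the family is closed under differentiation.\<close>
definition exp_pair :: "real \<Rightarrow> real \<Rightarrow> real \<Rightarrow> real \<Rightarrow> real \<Rightarrow> real \<Rightarrow> real \<Rightarrow> real \<Rightarrow> real" where
  "exp_pair \<alpha> \<gamma> k m a n b x =
    k + (m * x + a) * exp (\<alpha> * x) + (n * x + b) * exp (- \<gamma> * x)"

lemma DERIV_exp_pair:
  "(exp_pair \<alpha> \<gamma> k m a n b has_real_derivative
    exp_pair \<alpha> \<gamma> 0 (\<alpha> * m) (\<alpha> * a + m) (- \<gamma> * n) (- \<gamma> * b + n) x) (at x)"
  unfolding exp_pair_def
  by (auto intro!: derivative_eq_intros simp: algebra_simps)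

text \<open>When \<open>\<alpha>\<close> and \<open>-\<gamma>\<close> are characteristic roots, the linear factors \<open>m x\<close> and \<open>n x\<close> are the resonant
terms: the operator maps them to multiples of the pure exponentials.\<close>
lemma exp_pair_generator:
  assumes "\<kappa> * \<alpha>\<^sup>2 + d * \<alpha> = \<delta>" "\<kappa> * \<gamma>\<^sup>2 - d * \<gamma> = \<delta>"
  shows "\<kappa> * exp_pair \<alpha> \<gamma> 0 (\<alpha> * (\<alpha> * m)) (\<alpha> * (\<alpha> * a + m) + \<alpha> * m)
            (- \<gamma> * (- \<gamma> * n)) (- \<gamma> * (- \<gamma> * b + n) + - \<gamma> * n) x
      + d * exp_pair \<alpha> \<gamma> 0 (\<alpha> * m) (\<alpha> * a + m) (- \<gamma> * n) (- \<gamma> * b + n) x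
      - \<delta> * exp_pair \<alpha> \<gamma> k m a n b x
    = exp_pair \<alpha> \<gamma> (- \<delta> * k) 0 ((d + 2 * \<kappa> * \<alpha>) * m) 0 ((d - 2 * \<kappa> * \<gamma>) * n) x"
proof -
  have "\<kappa> * exp_pair \<alpha> \<gamma> 0 (\<alpha> * (\<alpha> * m)) (\<alpha> * (\<alpha> * a + m) + \<alpha> * m)
            (- \<gamma> * (- \<gamma> * n)) (- \<gamma> * (- \<gamma> * b + n) + - \<gamma> * n) x
      + d * exp_pair \<alpha> \<gamma> 0 (\<alpha> * m) (\<alpha> * a + m) (- \<gamma> * n) (- \<gamma> * b + n) x
      - \<delta> * exp_pair \<alpha> \<gamma> k m a n b x
    = - \<delta> * k + ((\<kappa> * \<alpha>\<^sup>2 + d * \<alpha> - \<delta>) * (m * x + a) + (d + 2 * \<kappa> * \<alpha>) * m) * exp (\<alpha> * x)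
      + ((\<kappa> * \<gamma>\<^sup>2 - d * \<gamma> - \<delta>) * (n * x + b) + (d - 2 * \<kappa> * \<gamma>) * n) * exp (- \<gamma> * x)"
    unfolding exp_pair_def by (simp add: algebra_simps power2_eq_square)
  then show ?thesis using assms by (simp add: exp_pair_def)
qed

lemma theta34_roots:
  assumes "\<sigma> > 0" "\<delta> > 0"
  shows "\<sigma>\<^sup>2 / 2 * (theta3 \<mu> \<sigma> \<delta>)\<^sup>2 + \<mu> * theta3 \<mu> \<sigma> \<delta> = \<delta>"
    and "\<sigma>\<^sup>2 / 2 * (theta4 \<mu> \<sigma> \<delta>)\<^sup>2 - \<mu> * theta4 \<mu> \<sigma> \<delta> = \<delta>"
    and "\<mu> + \<sigma>\<^sup>2 * theta3 \<mu> \<sigma> \<delta> > 0"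
    and "- \<mu> + \<sigma>\<^sup>2 * theta4 \<mu> \<sigma> \<delta> > 0"
proof -
  define w where "w = sqrt (\<mu>\<^sup>2 + 2 * \<delta> * \<sigma>\<^sup>2)"
  have pos: "\<mu>\<^sup>2 + 2 * \<delta> * \<sigma>\<^sup>2 > 0" using assms by (simp add: add_nonneg_pos)
  have w2: "w\<^sup>2 = \<mu>\<^sup>2 + 2 * \<delta> * \<sigma>\<^sup>2" unfolding w_def using pos by simp
  have "w > 0" unfolding w_def using pos by simp
  have t3: "\<sigma>\<^sup>2 * theta3 \<mu> \<sigma> \<delta> = - \<mu> + w" and t4: "\<sigma>\<^sup>2 * theta4 \<mu> \<sigma> \<delta> = \<mu> + w"
    using assms unfolding theta3_def theta4_def w_def by simp_all
  show "\<mu> + \<sigma>\<^sup>2 * theta3 \<mu> \<sigma> \<delta> > 0" "- \<mu> + \<sigma>\<^sup>2 * theta4 \<mu> \<sigma> \<delta> > 0"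
    using t3 t4 \<open>w > 0\<close> by simp_all
  have "\<sigma>\<^sup>2 * (\<sigma>\<^sup>2 / 2 * (theta3 \<mu> \<sigma> \<delta>)\<^sup>2 + \<mu> * theta3 \<mu> \<sigma> \<delta>)
      = (\<sigma>\<^sup>2 * theta3 \<mu> \<sigma> \<delta>)\<^sup>2 / 2 + \<mu> * (\<sigma>\<^sup>2 * theta3 \<mu> \<sigma> \<delta>)"
    by (simp add: power2_eq_square algebra_simps)
  also have "\<dots> = \<sigma>\<^sup>2 * \<delta>" unfolding t3 using w2 by (simp add: power2_eq_square field_simps)
  finally show "\<sigma>\<^sup>2 / 2 * (theta3 \<mu> \<sigma> \<delta>)\<^sup>2 + \<mu> * theta3 \<mu> \<sigma> \<delta> = \<delta>" using assms by simp
  have "\<sigma>\<^sup>2 * (\<sigma>\<^sup>2 / 2 * (theta4 \<mu> \<sigma> \<delta>)\<^sup>2 - \<mu> * theta4 \<mu> \<sigma> \<delta>)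
      = (\<sigma>\<^sup>2 * theta4 \<mu> \<sigma> \<delta>)\<^sup>2 / 2 - \<mu> * (\<sigma>\<^sup>2 * theta4 \<mu> \<sigma> \<delta>)"
    by (simp add: power2_eq_square algebra_simps)
  also have "\<dots> = \<sigma>\<^sup>2 * \<delta>" unfolding t4 using w2 by (simp add: power2_eq_square field_simps)
  finally show "\<sigma>\<^sup>2 / 2 * (theta4 \<mu> \<sigma> \<delta>)\<^sup>2 - \<mu> * theta4 \<mu> \<sigma> \<delta> = \<delta>" using assms by simp
qed

lemma theta12_shift:
  "theta1 \<mu> \<sigma> M \<delta> = theta3 (\<mu> + M) \<sigma> \<delta>" "theta2 \<mu> \<sigma> M \<delta> = theta4 (\<mu> + M) \<sigma> \<delta>"
  by (simp_all add: theta1_def theta2_def theta3_def theta4_def)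

lemma exp_pair_solves:
  assumes "\<kappa> * \<alpha>\<^sup>2 + d * \<alpha> = \<delta>" "\<kappa> * \<gamma>\<^sup>2 - d * \<gamma> = \<delta>"
  obtains y' y'' where "\<And>x. (exp_pair \<alpha> \<gamma> k m a n b has_real_derivative y' x) (at x)"
    and "\<And>x. (y' has_real_derivative y'' x) (at x)" "\<And>x. isCont y'' x"
    and "\<And>x. \<kappa> * y'' x + d * y' x - \<delta> * exp_pair \<alpha> \<gamma> k m a n b x
      = exp_pair \<alpha> \<gamma> (- \<delta> * k) 0 ((d + 2 * \<kappa> * \<alpha>) * m) 0 ((d - 2 * \<kappa> * \<gamma>) * n) x"
  using that[OF DERIV_exp_pair DERIV_exp_pair DERIV_isCont[OF DERIV_exp_pair]]
    exp_pair_generator[OF assms] by blast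

section \<open>Solution of the extended system\<close>

theorem proposition5p10:
  fixes \<mu> \<sigma> M c l \<delta> x1 x2 :: real
    and A B :: "nat \<Rightarrow> real"
    and V3 V4 \<beta> :: "real \<Rightarrow> real"
  assumes "\<mu> > 0" "\<sigma> > 0" "M > 0" "0 < c" "c < 1" "0 < l" "l < \<delta>"
    and beta: "\<beta> = (\<lambda>t. (1 + l * t) * exp (- \<delta> * t))"
    and x12: "0 < x1" "x1 < x2"
    and V3: "V3 = V3_fun \<mu> \<sigma> M c \<delta> x1 x2 A"
    and V4: "V4 = V4_fun \<mu> \<sigma> M c \<delta> l x1 x2 A B"
    and A_determined: "V3 0 = 0" "C1_at V3 x1" "C1_at V3 x2"
    and B_determined: "V4 0 = 0" "C1_at V4 x1" "C1_at V4 x2"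
    and V4_x1: "deriv V4 x1 = -1"
    and V4_x2: "((deriv (deriv V4)) \<longlongrightarrow> 0) (at_left x2)"
  shows "extended_HJB_solution \<mu> \<sigma> M c \<beta> x1 x2
           (\<lambda>x t s. exp (- \<delta> * (t - s)) * (l * (t - s) * V3 x + V4 x)) (\<lambda>x t. V4 x)
         \<and> strict_antimono_on {0..} V4 \<and> convex_on {0..} V4"
proof -
  have "0 < \<delta>" using assms by simp
  define \<kappa> where "\<kappa> = \<sigma>\<^sup>2 / 2"
  have "0 < \<kappa>" using \<open>\<sigma> > 0\<close> by (simp add: \<kappa>_def)
  define \<theta>1 \<theta>2 \<theta>3 \<theta>4 where \<theta>: "\<theta>1 = theta1 \<mu> \<sigma> M \<delta>" "\<theta>2 = theta2 \<mu> \<sigma> M \<delta>"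
    "\<theta>3 = theta3 \<mu> \<sigma> \<delta>" "\<theta>4 = theta4 \<mu> \<sigma> \<delta>"
  have root: "\<kappa> * \<theta>1\<^sup>2 + (\<mu> + M) * \<theta>1 = \<delta>" "\<kappa> * \<theta>2\<^sup>2 - (\<mu> + M) * \<theta>2 = \<delta>"
    "\<kappa> * \<theta>3\<^sup>2 + \<mu> * \<theta>3 = \<delta>" "\<kappa> * \<theta>4\<^sup>2 - \<mu> * \<theta>4 = \<delta>"
    using theta34_roots(1,2)[OF \<open>\<sigma> > 0\<close> \<open>0 < \<delta>\<close>] by (simp_all add: \<theta> \<kappa>_def theta12_shift)
  have den: "(\<mu> + M) + \<sigma>\<^sup>2 * \<theta>1 \<noteq> 0" "- (\<mu> + M) + \<sigma>\<^sup>2 * \<theta>2 \<noteq> 0"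
    "\<mu> + \<sigma>\<^sup>2 * \<theta>3 \<noteq> 0" "- \<mu> + \<sigma>\<^sup>2 * \<theta>4 \<noteq> 0"
    using theta34_roots(3,4)[OF \<open>\<sigma> > 0\<close> \<open>0 < \<delta>\<close>, of \<mu>]
      theta34_roots(3,4)[OF \<open>\<sigma> > 0\<close> \<open>0 < \<delta>\<close>, of "\<mu> + M"]
    unfolding \<theta> theta12_shift by linarith+
  \<comment> \<open>The coefficients of \<open>x\<close> in \<open>V\<^sub>4\<close>, chosen so that the resonant terms produce the forcing \<open>- l * V3\<close>.\<close>
  define m1 m2 m3 m4 where m: "m1 = - l * A 1 / ((\<mu> + M) + \<sigma>\<^sup>2 * \<theta>1)"
    "m2 = l * A 2 / (- (\<mu> + M) + \<sigma>\<^sup>2 * \<theta>2)"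
    "m3 = - l * A 3 / (\<mu> + \<sigma>\<^sup>2 * \<theta>3)" "m4 = l * A 4 / (- \<mu> + \<sigma>\<^sup>2 * \<theta>4)"
  have resonance: "((\<mu> + M) + 2 * \<kappa> * \<theta>1) * m1 = - l * A 1" "((\<mu> + M) - 2 * \<kappa> * \<theta>2) * m2 = - l * A 2"
    "(\<mu> + 2 * \<kappa> * \<theta>3) * m3 = - l * A 3" "(\<mu> - 2 * \<kappa> * \<theta>4) * m4 = - l * A 4"
    using den by (simp_all add: m \<kappa>_def divide_simps) (simp_all add: algebra_simps)
  define k4 where "k4 = M / \<delta> * (l / \<delta> + 1)"
  define L3 where "L3 = exp_pair \<theta>1 \<theta>2 (M / \<delta>) 0 (A 1) 0 (A 2)"
  define R3 where "R3 = exp_pair \<theta>3 \<theta>4 0 0 (A 3) 0 (A 4)"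
  define L4 where "L4 = exp_pair \<theta>1 \<theta>2 k4 m1 (B 1) m2 (B 2)"
  define R4 where "R4 = exp_pair \<theta>3 \<theta>4 0 m3 (B 3) m4 (B 4)"
  have forcing_L3: "exp_pair \<theta>1 \<theta>2 (- \<delta> * (M / \<delta>)) 0 (((\<mu> + M) + 2 * \<kappa> * \<theta>1) * 0) 0
      (((\<mu> + M) - 2 * \<kappa> * \<theta>2) * 0) x = - M" for x
    using \<open>0 < \<delta>\<close> by (simp add: exp_pair_def)
  have forcing_R3: "exp_pair \<theta>3 \<theta>4 (- \<delta> * 0) 0 ((\<mu> + 2 * \<kappa> * \<theta>3) * 0) 0
      ((\<mu> - 2 * \<kappa> * \<theta>4) * 0) x = 0" for x
    by (simp add: exp_pair_def)
  obtain L3' L3'' where L3': "\<And>x. (L3 has_real_derivative L3' x) (at x)"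
      "\<And>x. (L3' has_real_derivative L3'' x) (at x)"
    and ode_L3: "\<And>x. \<kappa> * L3'' x + (\<mu> + M) * L3' x - \<delta> * L3 x = - M"
    by (rule exp_pair_solves[OF root(1,2), of "M / \<delta>" 0 "A 1" 0 "A 2",
          folded L3_def, unfolded forcing_L3], rule that)
  obtain R3' R3'' where R3': "\<And>x. (R3 has_real_derivative R3' x) (at x)"
      "\<And>x. (R3' has_real_derivative R3'' x) (at x)"
    and ode_R3: "\<And>x. \<kappa> * R3'' x + \<mu> * R3' x - \<delta> * R3 x = 0"
    by (rule exp_pair_solves[OF root(3,4), of 0 0 "A 3" 0 "A 4",
          folded R3_def, unfolded forcing_R3], rule that)
  have k4: "- \<delta> * k4 = - l * (M / \<delta>) - M"
    using \<open>0 < \<delta>\<close> by (simp add: k4_def field_simps)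
  have forcing_L4: "exp_pair \<theta>1 \<theta>2 (- \<delta> * k4) 0 (((\<mu> + M) + 2 * \<kappa> * \<theta>1) * m1) 0
      (((\<mu> + M) - 2 * \<kappa> * \<theta>2) * m2) x = - l * L3 x - M" for x
    unfolding resonance k4 L3_def exp_pair_def by (simp add: algebra_simps)
  have forcing_R4: "exp_pair \<theta>3 \<theta>4 (- \<delta> * 0) 0 ((\<mu> + 2 * \<kappa> * \<theta>3) * m3) 0
      ((\<mu> - 2 * \<kappa> * \<theta>4) * m4) x = - l * R3 x" for x
    unfolding resonance R3_def exp_pair_def by (simp add: algebra_simps)
  obtain L4' L4'' where L4': "\<And>x. (L4 has_real_derivative L4' x) (at x)"
      "\<And>x. (L4' has_real_derivative L4'' x) (at x)"
    and ode_L4: "\<And>x. \<kappa> * L4'' x + (\<mu> + M) * L4' x - \<delta> * L4 x = - l * L3 x - M"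
    by (rule exp_pair_solves[OF root(1,2), of k4 m1 "B 1" m2 "B 2",
          folded L4_def, unfolded forcing_L4], rule that)
  obtain R4' R4'' where R4': "\<And>x. (R4 has_real_derivative R4' x) (at x)"
      "\<And>x. (R4' has_real_derivative R4'' x) (at x)" "\<And>x. isCont R4'' x"
    and ode_R4: "\<And>x. \<kappa> * R4'' x + \<mu> * R4' x - \<delta> * R4 x = - l * R3 x"
    by (rule exp_pair_solves[OF root(3,4), of 0 m3 "B 3" m4 "B 4",
          folded R4_def, unfolded forcing_R4], rule that)
  have V3_glue: "V3 = glue x1 x2 L3 R3 (\<lambda>x. - c * x + A 5)"
    unfolding V3 by (simp add: fun_eq_iff glue_def V3_fun_def L3_def R3_def exp_pair_def \<theta>)
  have V4_glue: "V4 = glue x1 x2 L4 R4 (\<lambda>x. - c * x + B 5)"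
  proof
    fix x
    show "V4 x = glue x1 x2 L4 R4 (\<lambda>x. - c * x + B 5) x"
      unfolding V4 glue_def V4_fun_def L4_def R4_def exp_pair_def k4_def m \<theta>[symmetric]
      by (simp add: distrib_right left_diff_distrib)
  qed
  note match3 = glue_C1_match[OF x12(2) L3'(1) R3'(1) DERIV_affine A_determined(2,3)[unfolded V3_glue]]
  note match4 = glue_C1_match[OF x12(2) L4'(1) R4'(1) DERIV_affine B_determined(2,3)[unfolded V4_glue]]
  \<comment> \<open>The formal second derivative of \<open>V4\<close> on the middle interval is \<open>R4''\<close>, continuous up to \<open>x2\<close>.\<close>
  have "R4'' x2 = 0"
  proof -
    have DERIV_mid: "(V4 has_real_derivative R4' x) (at x)" if "x1 < x" "x < x2" for x
      by (rule DERIV_transform_open[OF R4'(1), of "{x1<..<x2}"])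
        (use that in \<open>auto simp: V4_glue glue_def\<close>)
    have "deriv (deriv V4) x = R4'' x" if "x1 < x" "x < x2" for x
      by (rule DERIV_imp_deriv, rule DERIV_transform_open[OF R4'(2), of "{x1<..<x2}"])
        (use that in \<open>auto simp: DERIV_imp_deriv[OF DERIV_mid]\<close>)
    then have "eventually (\<lambda>x. deriv (deriv V4) x = R4'' x) (at_left x2)"
      using eventually_at_left_real[OF x12(2)] by (auto elim: eventually_mono)
    then have "(R4'' \<longlongrightarrow> 0) (at_left x2)"
      by (rule Lim_transform_eventually[OF V4_x2])
    moreover have "(R4'' \<longlongrightarrow> R4'' x2) (at_left x2)"
      using R4'(3) by (metis isCont_def filterlim_at_split)
    ultimately show ?thesis
      using tendsto_unique[OF trivial_limit_at_left_real] by blast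
  qed
  have "L3 0 = 0" "L4 0 = 0"
    using A_determined(1) B_determined(1) x12 by (simp_all add: V3_glue V4_glue glue_def)
  interpret free_boundary \<kappa> \<mu> M c l \<delta> x1 x2 "A 5" "B 5"
    L3 L3' L3'' R3 R3' R3'' L4 L4' L4'' R4 R4' R4''
    rewrites "free_boundary.V3 c x1 x2 (A 5) L3 R3 = V3"
      and "free_boundary.V4 c x1 x2 (B 5) L4 R4 = V4"
  proof -
    show fb: "free_boundary \<kappa> \<mu> M c l \<delta> x1 x2 (A 5) (B 5)
        L3 L3' L3'' R3 R3' R3'' L4 L4' L4'' R4 R4' R4''"
      by unfold_locales
        (use \<open>0 < \<kappa>\<close> assms(3-7) x12 L3' R3' L4' R4' ode_L3 ode_R3 ode_L4 ode_R4
          \<open>L3 0 = 0\<close> \<open>L4 0 = 0\<close> match3 match4 V4_x1[unfolded V4_glue] \<open>R4'' x2 = 0\<close> in auto)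
    show "free_boundary.V3 c x1 x2 (A 5) L3 R3 = V3"
      unfolding free_boundary.V3_def[OF fb] V3_glue ..
    show "free_boundary.V4 c x1 x2 (B 5) L4 R4 = V4"
      unfolding free_boundary.V4_def[OF fb] V4_glue ..
  qed
  have "f = (\<lambda>x t s. exp (- \<delta> * (t - s)) * (l * (t - s) * V3 x + V4 x))"
    by (simp add: f_def fun_eq_iff)
  then show ?thesis
    using extended_HJB_solution_f[of \<sigma>] strict_antimono_V4 convex_V4
    by (simp add: \<kappa>_def beta)
qed

end
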